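(* Let $y:\mathbb{N}\to\mathbb{R}$ be any monotone increasing function with $\frac{n}{2}<y(n)<n$ for all $n\in\mathbb{N}$, let $\mathcal{F}_y$ be the set of $y$-smooth positive integers and $\mathcal{G}_y=\{m+1:m\in\mathcal{F}_y\}$. Then for any $\mathcal{C}\subset\mathbb{N}$ with $\mathcal{C}\sim\mathcal{G}_y$ there is no decomposition $\mathcal{C}=\mathcal{A}\cdot\mathcal{B}$ with $\mathcal{A},\mathcal{B}\subset\mathbb{N}$, $|\mathcal{A}|\ge2$ and $2\le|\mathcal{B}|<+\infty$.
   Context: $\mathbb{N}$ denotes the positive integers. For $n\in\mathbb{N}$, $p^+(n)$ denotes the greatest prime factor of $n$; $n$ is $y$-smooth if $p^+(n)\le y(n)$, and $\mathcal{F}_y$ is the set of all $y$-smooth positive integers. $\mathcal{A}\cdot\mathcal{B}=\{ab:a\in\mathcal{A},b\in\mathcal{B}\}$. Two sets $\mathcal{C},\mathcal{C}'$ of non-negative integers satisfy $\mathcal{C}\sim\mathcal{C}'$ if there is $K$ with $\mathcal{C}\cap[K,+\infty)=\mathcal{C}'\cap[K,+\infty)$. *)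

theory Defs
  imports Complex_Main "HOL-Library.Set_Algebras" "HOL-Computational_Algebra.Primes"
begin

text \<open>
  The positive integers are rendered as \<^term>\<open>{1..} :: nat set\<close>. The product
  \<^term>\<open>A * B\<close> of sets of naturals is the elementwise product of
  \<^theory>\<open>HOL-Library.Set_Algebras\<close>.
\<close>

text \<open>
  The value at \<open>1\<close>, which has no prime factor, is set to \<open>1\<close> as is customary.
\<close>

definition greatest_prime_factor :: "nat \<Rightarrow> nat" where
  "greatest_prime_factor n = (if n = 1 then 1 else Max (prime_factors n))"

definition smooth_numbers :: "(nat \<Rightarrow> real) \<Rightarrow> nat set" where
  "smooth_numbers y = {n. n \<ge> 1 \<and> real (greatest_prime_factor n) \<le> y n}"

definition shifted_smooth_numbers :: "(nat \<Rightarrow> real) \<Rightarrow> nat set" where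
  "shifted_smooth_numbers y = {m + 1 |m. m \<in> smooth_numbers y}"

definition eventually_equal :: "nat set \<Rightarrow> nat set \<Rightarrow> bool" where
  "eventually_equal C C' \<longleftrightarrow> (\<exists>K. C \<inter> {K..} = C' \<inter> {K..})"

end

theory Submission
  imports Defs "HOL-Number_Theory.Number_Theory" "HOL-Computational_Algebra.Squarefree" "HOL-Computational_Algebra.Polynomial"
begin

text \<open>
  The bounds on \<open>y\<close> make \<open>\<F>\<^sub>y\<close> the set of composite numbers, so up to finitely many elements \<open>C\<close>
  consists of the \<open>n\<close> with \<open>n - 1\<close> composite. If \<open>C = A * B\<close> with \<open>B\<close> finite, an \<open>n \<in> C\<close> coprime to
  all elements of \<open>B\<close> must lie in \<open>A\<close>, and then \<open>b n \<in> C\<close> for all \<open>b \<in> B\<close>. By Dirichlet's theorem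
  there are primes \<open>p = b n - 1\<close> with \<open>n\<close> large, coprime to all elements of \<open>B\<close>, and \<open>n - 1\<close> divisible
  by a fixed prime; this contradicts \<open>b n \<in> C\<close>. The only local obstruction is at \<open>2\<close>, and it is
  avoided by taking \<open>b\<close> even whenever \<open>B\<close> contains an even number.

  Dirichlet's theorem is proved in Mertens' and Shapiro's way: for a nonprincipal character \<open>\<chi>\<close> the
  sums of \<open>\<chi>(n) \<Lambda>(n) / n\<close> over \<open>n \<le> N\<close> are bounded if \<open>L(1,\<chi>) \<noteq> 0\<close> and equal \<open>-ln N + O(1)\<close> otherwise.
\<close>

section \<open>Sums over divisors\<close>

text \<open>Why parity is the only obstruction: let \<open>l\<close> be a prime dividing some
  element of \<open>B\<close>. If \<open>l\<close> divides \<open>b\<close>, then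
  \<open>b n - 1\<close> is automatically prime to \<open>l\<close>. Otherwise two classes of
  \<open>n\<close> modulo \<open>l\<close> are forbidden, \<open>n = 0\<close> and
  \<open>n = 1/b\<close>. The class with \<open>b n = 2\<close> avoids both, unless
  \<open>l = 2\<close>, where the two forbidden classes are all there is. Dirichlet's theorem is
  reduced to estimates of finite sums with weight \<open>1/n\<close>. Its two delicate inputs are
  the non-vanishing of \<open>L(1,\<chi>)\<close> for real \<open>\<chi>\<close>, where a Lambert
  series has to stay bounded as \<open>t\<close> tends to 1, and the supply of characters. The
  latter are obtained as normalised common eigenfunctions of translations, instead of from a
  decomposition of the unit group into cyclic factors.\<close>

lemma sum_divisors_swap:
  fixes f :: "nat \<Rightarrow> nat \<Rightarrow> 'a::comm_monoid_add"
  shows "(\<Sum>n=1..N. \<Sum>d | d dvd n. f d (n div d)) = (\<Sum>d=1..N. \<Sum>k=1..N div d. f d k)"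
proof -
  have "(\<Sum>n=1..N. \<Sum>d | d dvd n. f d (n div d)) =
        (\<Sum>(n,d)\<in>(SIGMA n:{1..N}. {d. d dvd n}). f d (n div d))"
    by (subst sum.Sigma) auto
  also have "\<dots> = (\<Sum>(d,k)\<in>(SIGMA d:{1..N}. {1..N div d}). f d k)"
  proof (rule sum.reindex_bij_witness[where i="\<lambda>(d,k). (d*k, d)" and j="\<lambda>(n,d). (d, n div d)"], goal_cases)
    case (2 a)
    then obtain n d where a: "a = (n, d)" "1 \<le> n" "n \<le> N" "d dvd n" by auto
    then obtain k where k: "n = d * k" by auto
    with a have "d > 0" "k > 0" by auto
    with a k show ?case by (auto simp: less_eq_div_iff_mult_less_eq mult.commute) (metis le_trans nat_le_linear mult_le_mono1 mult_1 Suc_leI One_nat_def mult.commute)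
  next
    case (4 b)
    then obtain d k where b: "b = (d,k)" "1 \<le> d" "d \<le> N" "1 \<le> k" "k \<le> N div d" by auto
    then show ?case by (auto simp: less_eq_div_iff_mult_less_eq mult.commute)
  qed auto
  also have "\<dots> = (\<Sum>d=1..N. \<Sum>k=1..N div d. f d k)"
    by (subst sum.Sigma) auto
  finally show ?thesis .
qed

text \<open>A divisor containing \<open>p\<close> exactly once is \<open>p * d\<close> with
  \<open>d\<close> prime to \<open>p\<close>, and \<open>f\<close> vanishes on those containing it
  more often. The terms are kept in pairs so that the sign change of \<open>moebius\<close> acts
  inside each pair.\<close>

lemma sum_divisors_prime_split:
  fixes f :: "nat \<Rightarrow> 'a::comm_monoid_add" and p n :: nat
  assumes "prime p" "p dvd n" "n > 0"
    and "\<And>d. p\<^sup>2 dvd d \<Longrightarrow> f d = 0"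
  shows "(\<Sum>d | d dvd n. f d) = (\<Sum>d | d dvd n \<and> \<not> p dvd d. f d + f (p * d))"
proof -
  let ?A = "{d. d dvd n \<and> \<not> p dvd d}"
  have fin: "finite {d. d dvd n}" using assms by simp
  have finA: "finite ?A" by (rule finite_subset[OF _ fin]) auto
  have inj: "inj_on ((*) p) ?A" using assms(1) by (auto simp: inj_on_def)
  have disj: "?A \<inter> (*) p ` ?A = {}" by auto
  have sub: "?A \<union> (*) p ` ?A \<subseteq> {d. d dvd n}"
  proof -
    have "p * d dvd n" if "d dvd n" "\<not> p dvd d" for d
      using that assms by (intro divides_mult) (auto simp: prime_imp_coprime)
    thus ?thesis by auto
  qed
  have "(\<Sum>d | d dvd n. f d) = (\<Sum>d\<in>?A \<union> (*) p ` ?A. f d)"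
  proof (rule sum.mono_neutral_right[OF fin sub], rule ballI)
    fix d assume "d \<in> {d. d dvd n} - (?A \<union> (*) p ` ?A)"
    hence d: "d dvd n" "d \<notin> (*) p ` ?A" and "p dvd d" by auto
    then obtain e where e: "d = p * e" by auto
    have "p dvd e"
    proof (rule ccontr)
      assume "\<not> p dvd e"
      moreover have "e dvd n" using d e by (meson dvd_mult_right)
      ultimately show False using d e by auto
    qed
    hence "p\<^sup>2 dvd d" using e by (simp add: power2_eq_square mult_dvd_mono)
    thus "f d = 0" by (rule assms(4))
  qed
  also have "\<dots> = sum f ?A + sum f ((*) p ` ?A)"
    by (rule sum.union_disjoint) (use finA disj in auto)
  also have "sum f ((*) p ` ?A) = (\<Sum>d\<in>?A. f (p * d))"
    by (subst sum.reindex[OF inj]) simp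
  finally show ?thesis by (simp add: sum.distrib)
qed

section \<open>The Moebius function and its divisor sums\<close>

definition moebius :: "nat \<Rightarrow> real" where
  "moebius n = (if squarefree n then (-1) ^ card (prime_factors n) else 0)"

lemma moebius_1 [simp]: "moebius (Suc 0) = 1"
  by (simp add: moebius_def)

lemma abs_moebius_le: "\<bar>moebius n\<bar> \<le> 1"
  by (simp add: moebius_def)

lemma moebius_prime_mult:
  assumes "prime p" "\<not> p dvd d"
  shows "moebius (p * d) = - moebius d"
proof -
  have cop: "coprime p d" using assms by (simp add: prime_imp_coprime)
  have d0: "d \<noteq> 0" using assms(2) by (metis dvd_0_right)
  have "squarefree (p * d) \<longleftrightarrow> squarefree d"
    using cop assms by (metis squarefree_mult_coprime squarefree_multD(2) squarefree_prime)
  moreover have "prime_factors (p * d) = insert p (prime_factors d)"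
    using assms d0 by (auto simp: prime_factors_product prime_prime_factors)
  moreover have "p \<notin> prime_factors d" using assms by auto
  ultimately show ?thesis by (simp add: moebius_def)
qed

lemma moebius_sum:
  assumes "n > 0"
  shows "(\<Sum>d | d dvd n. moebius d) = (if n = 1 then 1 else 0)"
proof (cases "n = 1")
  case False
  then obtain p where p: "prime p" "p dvd n" using assms prime_factor_nat by blast
  have "(\<Sum>d | d dvd n. moebius d) = (\<Sum>d | d dvd n \<and> \<not> p dvd d. moebius d + moebius (p * d))"
    using p assms by (intro sum_divisors_prime_split) (auto simp: moebius_def squarefree_def)
  also have "\<dots> = 0" using p by (intro sum.neutral) (auto simp: moebius_prime_mult)
  finally show ?thesis using False by simp
qed auto

text \<open>In each pair \<open>d\<close>, \<open>p * d\<close> the logarithms differ by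
  \<open>ln p\<close> and the signs are opposite, which leaves \<open>- moebius d * ln p\<close>.
  Summed over the divisors of the \<open>p\<close>-free part \<open>m\<close> of \<open>n\<close>
  this vanishes unless \<open>m = 1\<close>, that is, unless \<open>n\<close> is a power of
  \<open>p\<close>.\<close>

lemma moebius_ln_sum:
  assumes "n > 0"
  shows "(\<Sum>d | d dvd n. moebius d * ln (real d)) = - mangoldt n"
proof (cases "n = 1")
  case False
  then obtain p where p: "prime p" "p dvd n" using assms prime_factor_nat by blast
  from p assms obtain k m where km: "n = p ^ k * m" "\<not> p dvd m" "k > 0"
    by (metis multiplicity_decompose' multiplicity_gt_zero_iff not_gr_zero prime_def prime_elem_def not_less_zero)
  have m: "m > 0" using km by (metis dvd_0_right not_gr_zero)
  have dm: "d dvd n \<and> \<not> p dvd d \<longleftrightarrow> d dvd m" for d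
  proof
    assume "d dvd n \<and> \<not> p dvd d"
    moreover from this have "coprime d (p ^ k)" using p
      by (metis coprime_commute coprime_power_left_iff prime_imp_coprime)
    ultimately show "d dvd m" using km by (simp add: coprime_dvd_mult_right_iff)
  qed (use km in \<open>auto intro: dvd_trans\<close>)
  have "(\<Sum>d | d dvd n. moebius d * ln (real d)) =
        (\<Sum>d | d dvd n \<and> \<not> p dvd d. moebius d * ln (real d) + moebius (p * d) * ln (real (p * d)))"
    using p assms by (intro sum_divisors_prime_split) (auto simp: moebius_def squarefree_def)
  also have "\<dots> = (\<Sum>d | d dvd m. moebius d * (- ln (real p)))"
  proof (rule sum.cong)
    show "{d. d dvd n \<and> \<not> p dvd d} = {d. d dvd m}" using dm by auto
    fix d assume "d \<in> {d. d dvd m}"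
    hence d: "\<not> p dvd d" "d > 0" using dm m by (auto intro!: Nat.gr0I)
    have p0: "p > 0" using p by (simp add: prime_gt_0_nat)
    show "moebius d * ln (real d) + moebius (p * d) * ln (real (p * d)) = moebius d * (- ln (real p))"
      unfolding moebius_prime_mult[OF p(1) d(1)] using d p0 by (simp add: ln_mult distrib_left)
  qed
  also have "\<dots> = (if m = 1 then - ln (real p) else 0)"
    using moebius_sum[OF m] by (simp add: sum_distrib_right[symmetric] sum_negf)
  also have "\<dots> = - mangoldt n"
  proof (cases "m = 1")
    case True
    then show ?thesis using km p by simp
  next
    case False
    have "\<not> primepow n"
    proof
      assume "primepow n"
      then obtain r j where r: "prime r" "n = r ^ j" "j > 0" by (auto simp: primepow_def)
      have "r = p" using p r by (metis prime_dvd_power primes_dvd_imp_eq)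
      moreover have "m dvd n" using km by simp
      moreover have "coprime m (r ^ j)" using calculation km p r
        by (metis coprime_commute coprime_power_left_iff prime_imp_coprime)
      ultimately have "m = 1" using r by (metis coprime_common_divisor dvd_refl nat_dvd_1_iff_1)
      thus False using False by simp
    qed
    then show ?thesis using False by (simp add: mangoldt_def)
  qed
  finally show ?thesis .
qed auto

section \<open>Bounds for the Chebyshev function\<close>

text \<open>Legendre's formula in logarithmic form: \<open>N div d\<close> counts the multiples of
  \<open>d\<close> up to \<open>N\<close>.\<close>

lemma ln_fact_mangoldt:
  "ln (fact N) = (\<Sum>d=1..N. mangoldt d * real (N div d))"
proof -
  have "ln (fact N :: real) = (\<Sum>n=1..N. ln (real n))"
    unfolding fact_prod by (subst of_nat_prod, subst ln_prod) auto
  also have "\<dots> = (\<Sum>n=1..N. \<Sum>d | d dvd n. mangoldt d)"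
    by (intro sum.cong refl) (subst mangoldt_sum, auto)
  also have "\<dots> = (\<Sum>d=1..N. \<Sum>k=1..N div d. mangoldt d)"
    by (rule sum_divisors_swap)
  finally show ?thesis by (simp add: mult.commute)
qed

definition chebyshev_psi :: "nat \<Rightarrow> real" where
  "chebyshev_psi N = (\<Sum>d=1..N. mangoldt d)"

text \<open>Chebyshev's argument. In the logarithm of the central binomial coefficient,
  \<open>mangoldt d\<close> has the weight \<open>2 * N div d - 2 * (N div d)\<close>, which is 1
  for \<open>N < d \<le> 2 * N\<close> and never negative. The coefficient is at most
  \<open>4 ^ N\<close>, and \<open>ln 4 \<le> 2\<close>.\<close>

lemma chebyshev_psi_double: "chebyshev_psi (2 * N) \<le> chebyshev_psi N + 2 * real N"
proof -
  have ge: "2 * (N div d) \<le> 2 * N div d" for d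
    by (metis div_mult2_eq mult.commute div_mult1_eq le_add1)
  have "chebyshev_psi (2 * N) - chebyshev_psi N = (\<Sum>d=N+1..2*N. mangoldt d)"
    unfolding chebyshev_psi_def
    using sum.ub_add_nat[of 1 N "mangoldt :: nat \<Rightarrow> real" N] by (simp add: mult_2)
  also have "\<dots> \<le> (\<Sum>d=N+1..2*N. mangoldt d * (real (2 * N div d) - 2 * real (N div d)))"
  proof (rule sum_mono)
    fix d assume d: "d \<in> {N+1..2*N}"
    have "2 * N div d = 1" using d by (intro div_nat_eqI) auto
    moreover have "N div d = 0" using d by simp
    ultimately show "mangoldt d \<le> mangoldt d * (real (2 * N div d) - 2 * real (N div d))" by simp
  qed
  also have "\<dots> \<le> (\<Sum>d=1..2*N. mangoldt d * (real (2 * N div d) - 2 * real (N div d)))"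
    by (rule sum_mono2) (auto intro!: mult_nonneg_nonneg mangoldt_nonneg, use ge in \<open>metis of_nat_le_iff of_nat_mult of_nat_numeral\<close>)
  also have "\<dots> = ln (fact (2 * N)) - 2 * (\<Sum>d=1..2*N. mangoldt d * real (N div d))"
    by (simp add: ln_fact_mangoldt algebra_simps sum_subtractf sum_distrib_left)
  also have "(\<Sum>d=1..2*N. mangoldt d * real (N div d)) = (\<Sum>d=1..N. mangoldt d * real (N div d))"
    by (rule sum.mono_neutral_right) auto
  also have "\<dots> = ln (fact N)" by (simp add: ln_fact_mangoldt)
  also have "ln (fact (2 * N) :: real) - 2 * ln (fact N) = ln (real ((2 * N) choose N))"
  proof -
    have "real ((2 * N) choose N) = fact (2 * N) / (fact N * fact N)"
      by (subst binomial_fact) (auto simp: mult_2)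
    thus ?thesis by (simp add: ln_div ln_mult)
  qed
  also have "\<dots> \<le> ln (2 ^ (2 * N))"
  proof -
    have "real ((2 * N) choose N) \<le> real (2 ^ (2 * N))"
      using binomial_le_pow2[of "2 * N" N] of_nat_le_iff by blast
    thus ?thesis by (subst ln_le_cancel_iff) auto
  qed
  also have "\<dots> = real N * (2 * ln 2)" by (simp add: ln_realpow)
  also have "\<dots> \<le> real N * 2" using ln_2_less_1 by (intro mult_left_mono) auto
  finally show ?thesis by simp
qed

text \<open>Halving the argument. The constant comes from the odd step, where the doubling adds
  \<open>2 k\<close> and the single new term is bounded crudely by \<open>2 k + 1\<close>.\<close>

lemma chebyshev_psi_le: "chebyshev_psi N \<le> 4 * real N"
proof (induction N rule: less_induct)
  case (less N)
  consider "N = 0" | k where "N = 2 * k" "k > 0" | k where "N = 2 * k + 1"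
    by (metis oddE evenE mult_is_0 not_gr_zero)
  then show ?case
  proof cases
    case 1 thus ?thesis by (simp add: chebyshev_psi_def)
  next
    case 2
    have "chebyshev_psi k \<le> 4 * real k" using 2 by (intro less) auto
    thus ?thesis using chebyshev_psi_double[of k] 2 by simp
  next
    case 3
    have "chebyshev_psi k \<le> 4 * real k" using 3 by (intro less) auto
    moreover have "chebyshev_psi (2 * k + 1) = chebyshev_psi (2 * k) + mangoldt (2 * k + 1)"
      by (simp add: chebyshev_psi_def)
    moreover have "mangoldt (2 * k + 1) \<le> ln (real (2 * k + 1))"
      by (rule mangoldt_le) simp
    moreover have "ln (real (2 * k + 1)) \<le> 2 * real k + 1"
      using ln_le_minus_one[of "real (2 * k + 1)"] by simp
    ultimately show ?thesis using chebyshev_psi_double[of k] 3 by simp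
  qed
qed

text \<open>One half of Mertens' estimate: replacing \<open>N / n\<close> by \<open>N div n\<close>
  costs at most \<open>chebyshev_psi N\<close>, hence the 4, and the main term is
  \<open>ln N! \<le> N ln N\<close>.\<close>

lemma mangoldt_div_sum_le:
  assumes "N > 0"
  shows "(\<Sum>n=1..N. mangoldt n / real n) \<le> ln (real N) + 4"
proof -
  have "real N * (\<Sum>n=1..N. mangoldt n / real n) = (\<Sum>n=1..N. mangoldt n * (real N / real n))"
    by (simp add: sum_distrib_left mult_ac)
  also have "\<dots> \<le> (\<Sum>n=1..N. mangoldt n * (real (N div n) + 1))"
  proof (intro sum_mono mult_left_mono mangoldt_nonneg)
    fix n assume "n \<in> {1..N}"
    have "real N / real n < real_of_int \<lfloor>real N / real n\<rfloor> + 1" by linarith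
    thus "real N / real n \<le> real (N div n) + 1" by (simp add: floor_divide_of_nat_eq)
  qed
  also have "\<dots> = ln (fact N) + chebyshev_psi N"
    by (simp add: ln_fact_mangoldt chebyshev_psi_def algebra_simps sum.distrib)
  also have "ln (fact N :: real) \<le> ln (real N ^ N)"
    using assms fact_le_power[of N, where ?'a = real] by (subst ln_le_cancel_iff) auto
  also have "ln (real N ^ N) + chebyshev_psi N \<le> real N * (ln (real N) + 4)"
    using chebyshev_psi_le[of N] assms by (simp add: ln_realpow algebra_simps)
  finally show ?thesis using assms by simp
qed

section \<open>Bounded completely multiplicative functions\<close>

text \<open>Abel summation: the weights \<open>f i - f (Suc i)\<close> and the boundary weight
  \<open>f k\<close> are nonnegative and telescope to \<open>f 0\<close>.\<close>

lemma norm_sum_scaleR_antimono_le: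
  fixes c :: "nat \<Rightarrow> 'a::real_normed_vector" and f :: "nat \<Rightarrow> real"
  assumes "\<And>k. norm (\<Sum>i<k. c i) \<le> M" "\<And>i. f (Suc i) \<le> f i" "\<And>i. f i \<ge> 0"
  shows "norm (\<Sum>i<k. f i *\<^sub>R c i) \<le> M * f 0"
proof -
  define C where "C k = (\<Sum>i<k. c i)" for k
  have eq: "(\<Sum>i<k. f i *\<^sub>R c i) = (\<Sum>i<k. (f i - f (Suc i)) *\<^sub>R C (Suc i)) + f k *\<^sub>R C k"
    by (induction k) (auto simp: C_def algebra_simps)
  have "norm (\<Sum>i<k. f i *\<^sub>R c i) \<le> norm (\<Sum>i<k. (f i - f (Suc i)) *\<^sub>R C (Suc i)) + norm (f k *\<^sub>R C k)"
    unfolding eq by (rule norm_triangle_ineq)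
  also have "\<dots> \<le> (\<Sum>i<k. (f i - f (Suc i)) * M) + f k * M"
  proof (rule add_mono)
    show "norm (\<Sum>i<k. (f i - f (Suc i)) *\<^sub>R C (Suc i)) \<le> (\<Sum>i<k. (f i - f (Suc i)) * M)"
    proof (rule sum_norm_le)
      fix i
      have "norm ((f i - f (Suc i)) *\<^sub>R C (Suc i)) = (f i - f (Suc i)) * norm (C (Suc i))"
        using assms(2)[of i] by simp
      also have "\<dots> \<le> (f i - f (Suc i)) * M"
        unfolding C_def using assms(1)[of "Suc i"] assms(2)[of i] by (intro mult_left_mono) simp_all
      finally show "norm ((f i - f (Suc i)) *\<^sub>R C (Suc i)) \<le> (f i - f (Suc i)) * M" .
    qed
    have "norm (f k *\<^sub>R C k) = f k * norm (C k)" using assms(3) by simp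
    also have "\<dots> \<le> f k * M" using assms(1,3) unfolding C_def by (intro mult_left_mono) auto
    finally show "norm (f k *\<^sub>R C k) \<le> f k * M" .
  qed
  also have "\<dots> = M * f 0"
    unfolding sum_distrib_right[symmetric] sum_lessThan_telescope' by (simp add: algebra_simps)
  finally show ?thesis .
qed

lemma ln_Suc_diff_le:
  assumes "n > 0"
  shows "real n * (ln (real (Suc n)) - ln (real n)) \<le> 1"
proof -
  have "ln (real (Suc n)) - ln (real n) = ln (real (Suc n) / real n)"
    using assms by (simp add: ln_div)
  also have "real (Suc n) / real n = 1 + 1 / real n" using assms by (simp add: field_simps)
  also have "ln \<dots> \<le> 1 / real n" by (rule ln_add_one_self_le_self) simp
  finally show ?thesis using assms by (simp add: field_simps)
qed

lemma ln_fact_ge: "real N * ln (real N) - real N \<le> ln (fact N)"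
proof (induction N)
  case (Suc N)
  show ?case
  proof (cases "N = 0")
    case False
    hence "real N * (ln (real (Suc N)) - ln (real N)) \<le> 1" by (intro ln_Suc_diff_le) simp
    moreover have "ln (fact (Suc N) :: real) = ln (real (Suc N)) + ln (fact N)"
      by (simp add: ln_mult del: of_nat_Suc)
    ultimately show ?thesis using Suc by (simp add: algebra_simps)
  qed simp
qed simp

text \<open>The function \<open>ln x / x\<close> decreases only beyond \<open>x = e\<close>, hence
  the threshold 3.\<close>

lemma ln_div_antimono:
  assumes "n \<ge> 3"
  shows "ln (real (Suc n)) / real (Suc n) \<le> ln (real n) / real n"
proof -
  have "exp 1 \<le> (3::real)" using exp_le by simp
  hence "1 \<le> ln (3::real)" by (subst ln_ge_iff) auto
  also have "\<dots> \<le> ln (real n)" using assms by simp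
  finally have ln1: "1 \<le> ln (real n)" .
  have "real n * (ln (real (Suc n)) - ln (real n)) \<le> 1" using assms by (intro ln_Suc_diff_le) simp
  hence "real n * ln (real (Suc n)) \<le> real (Suc n) * ln (real n)" using ln1 by (simp add: algebra_simps)
  thus ?thesis using assms by (simp add: divide_le_eq pos_le_divide_eq mult_ac)
qed

text \<open>Partial sums of the Dirichlet series of \<open>-L'/L\<close> at 1. They stand outside
  the locale below because they are also taken for the principal character, whose own partial sums
  are unbounded.\<close>

definition twisted_mangoldt_sum :: "(nat \<Rightarrow> complex) \<Rightarrow> nat \<Rightarrow> complex" where
  "twisted_mangoldt_sum \<chi> N = (\<Sum>n=1..N. \<chi> n * of_real (mangoldt n / real n))"

text \<open>Models a nonprincipal Dirichlet character; the bound \<open>M\<close> carries the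
  cancellation over a full period.\<close>

locale bounded_character =
  fixes \<chi> :: "nat \<Rightarrow> complex" and M :: real
  assumes mult: "\<chi> (a * b) = \<chi> a * \<chi> b"
    and one: "\<chi> 1 = 1"
    and norm_le_1: "norm (\<chi> n) \<le> 1"
    and partial_sum_le: "norm (\<Sum>n=1..N. \<chi> n) \<le> M"
begin

lemma M_nonneg: "M \<ge> 0"
  using partial_sum_le[of 0] by simp

lemma norm_sum_antimono_le:
  fixes f :: "nat \<Rightarrow> real"
  assumes "a \<ge> 1" "\<And>n. n \<ge> a \<Longrightarrow> f (Suc n) \<le> f n" "\<And>n. n \<ge> a \<Longrightarrow> f n \<ge> 0"
  shows "norm (\<Sum>n=a..<b. \<chi> n * of_real (f n)) \<le> 2 * M * f a"
proof (cases "a \<le> b")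
  case True
  have shift: "(\<Sum>n=a..<a+k. g n) = (\<Sum>i<k. g (i + a))" for g :: "nat \<Rightarrow> complex" and k
    using sum.shift_bounds_nat_ivl[of g 0 a k] by (simp add: atLeast0LessThan add.commute)
  \<comment> \<open>A block of values is the difference of two initial sums; this is the origin of
    the factor 2.\<close>
  have "norm (\<Sum>i<k. \<chi> (i + a)) \<le> 2 * M" for k
  proof -
    have "(\<Sum>n=1..<a+k. \<chi> n) = (\<Sum>n=1..<a. \<chi> n) + (\<Sum>n=a..<a+k. \<chi> n)"
      using assms by (subst sum.atLeastLessThan_concat) auto
    moreover have "{1..<a+k} = {1..a+k-1}" "{1..<a} = {1..a-1}" using assms by auto
    ultimately have eq: "(\<Sum>i<k. \<chi> (i + a)) = (\<Sum>n=1..a+k-1. \<chi> n) - (\<Sum>n=1..a-1. \<chi> n)"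
      by (simp add: shift)
    have "norm (\<Sum>i<k. \<chi> (i + a)) \<le> norm (\<Sum>n=1..a+k-1. \<chi> n) + norm (\<Sum>n=1..a-1. \<chi> n)"
      unfolding eq by (rule norm_triangle_ineq4)
    thus ?thesis using partial_sum_le[of "a+k-1"] partial_sum_le[of "a-1"] by linarith
  qed
  hence "norm (\<Sum>i<b-a. f (i + a) *\<^sub>R \<chi> (i + a)) \<le> 2 * M * f (0 + a)"
    using assms by (intro norm_sum_scaleR_antimono_le[where f = "\<lambda>i. f (i + a)"]) auto
  moreover have "(\<Sum>n=a..<b. \<chi> n * of_real (f n)) = (\<Sum>i<b-a. f (i + a) *\<^sub>R \<chi> (i + a))"
    using True shift[of "\<lambda>n. \<chi> n * of_real (f n)" "b - a"] by (simp add: scaleR_conv_of_real mult.commute)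
  ultimately show ?thesis by simp
next
  case False
  then show ?thesis using assms(3)[of a] M_nonneg by simp
qed

definition G :: "nat \<Rightarrow> complex" where
  "G N = (\<Sum>k=1..N. \<chi> k / of_nat k)"

text \<open>This is \<open>L(1,\<chi>)\<close>, with \<open>G\<close> its partial sums;
  \<open>G_tendsto\<close> justifies the use of \<open>lim\<close>.\<close>

definition L :: complex where
  "L = lim G"

abbreviation S :: "nat \<Rightarrow> complex" where
  "S \<equiv> twisted_mangoldt_sum \<chi>"

lemma norm_G_diff_le:
  assumes "a \<le> b"
  shows "norm (G b - G a) \<le> 2 * M / real (Suc a)"
proof -
  have "G b = G a + (\<Sum>n=Suc a..<Suc b. \<chi> n * of_real (1 / real n))"
    unfolding G_def using assms sum.atLeastLessThan_concat[of 1 "Suc a" "Suc b" "\<lambda>k. \<chi> k / of_nat k"]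
    by (simp add: atLeastLessThanSuc_atLeastAtMost)
  moreover have "norm (\<Sum>n=Suc a..<Suc b. \<chi> n * of_real (1 / real n)) \<le> 2 * M * (1 / real (Suc a))"
    by (rule norm_sum_antimono_le) (auto simp: field_simps)
  ultimately show ?thesis by simp
qed

lemma G_tendsto: "G \<longlonglongrightarrow> L"
proof -
  have "Cauchy G"
  proof (rule CauchyI')
    fix e :: real assume e: "e > 0"
    obtain a where a: "2 * M / e < real a" using reals_Archimedean2 by blast
    show "\<exists>K. \<forall>m\<ge>K. \<forall>n>m. dist (G m) (G n) < e"
      unfolding dist_norm
    proof (intro exI allI impI)
      fix m n assume mn: "a \<le> m" "m < n"
      have "norm (G m - G n) \<le> 2 * M / real (Suc m)"
        using norm_G_diff_le[of m n] mn by (simp add: norm_minus_commute)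
      also have "\<dots> < e"
      proof -
        have "2 * M / e < real (Suc m)" using a mn by simp
        thus ?thesis using e by (simp add: field_simps del: of_nat_Suc)
      qed
      finally show "norm (G m - G n) < e" .
    qed
  qed
  thus ?thesis unfolding L_def by (simp add: Cauchy_convergent convergent_LIMSEQ_iff[symmetric])
qed

lemma norm_L_diff_le: "norm (L - G a) \<le> 2 * M / real (Suc a)"
proof (rule LIMSEQ_le_const2)
  show "(\<lambda>b. norm (G b - G a)) \<longlonglongrightarrow> norm (L - G a)"
    by (intro tendsto_intros G_tendsto)
qed (use norm_G_diff_le in blast)

text \<open>In this form the factor \<open>d\<close> cancels the \<open>1/d\<close> of the weights
  in the convolution sums, leaving \<open>2 * M / N\<close> times a sum of order
  \<open>N\<close>.\<close>

lemma norm_L_diff_div_le: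
  assumes "1 \<le> d" "d \<le> N"
  shows "norm (L - G (N div d)) \<le> 2 * M * real d / real N"
proof -
  have "N < d * Suc (N div d)" using assms by (metis dividend_less_times_div mult_Suc_right less_le_trans zero_less_one)
  hence "real N \<le> real d * real (Suc (N div d))" by (metis less_imp_le of_nat_le_iff of_nat_mult)
  hence "1 / real (Suc (N div d)) \<le> real d / real N"
    using assms by (simp add: field_simps del: of_nat_Suc)
  hence "2 * M * (1 / real (Suc (N div d))) \<le> 2 * M * (real d / real N)"
    using M_nonneg by (intro mult_left_mono) auto
  thus ?thesis using norm_L_diff_le[of "N div d"] by simp
qed

text \<open>Complete multiplicativity splits the term at \<open>n = d * k\<close>. Collecting by
  \<open>d\<close> produces \<open>G (N div d)\<close>, which can then be compared with
  \<open>L\<close>.\<close>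

lemma sum_mult_divisor_sum:
  "(\<Sum>n=1..N. \<chi> n / of_nat n * of_real (\<Sum>d | d dvd n. g d)) =
   (\<Sum>d=1..N. \<chi> d * of_real (g d / real d) * G (N div d))"
proof -
  have "(\<Sum>n=1..N. \<chi> n / of_nat n * of_real (\<Sum>d | d dvd n. g d)) =
     (\<Sum>n=1..N. \<Sum>d | d dvd n. \<chi> d * of_real (g d / real d) * (\<chi> (n div d) / of_nat (n div d)))"
  proof (rule sum.cong[OF refl])
    fix n assume n: "n \<in> {1..N}"
    show "\<chi> n / of_nat n * of_real (\<Sum>d | d dvd n. g d) =
          (\<Sum>d | d dvd n. \<chi> d * of_real (g d / real d) * (\<chi> (n div d) / of_nat (n div d)))"
      unfolding of_real_sum sum_distrib_left
    proof (rule sum.cong[OF refl])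
      fix d assume "d \<in> {d. d dvd n}"
      then obtain k where k: "n = d * k" by auto
      with n have "d > 0" "k > 0" by auto
      thus "\<chi> n / of_nat n * of_real (g d) = \<chi> d * of_real (g d / real d) * (\<chi> (n div d) / of_nat (n div d))"
        unfolding k by (simp add: mult field_simps)
    qed
  qed
  also have "\<dots> = (\<Sum>d=1..N. \<Sum>k=1..N div d. \<chi> d * of_real (g d / real d) * (\<chi> k / of_nat k))"
    by (rule sum_divisors_swap)
  also have "\<dots> = (\<Sum>d=1..N. \<chi> d * of_real (g d / real d) * G (N div d))"
    by (simp add: G_def sum_distrib_left)
  finally show ?thesis .
qed

text \<open>Writing \<open>ln n\<close> as a divisor sum of \<open>mangoldt\<close> expresses
  \<open>T N\<close> through the terms of \<open>S N\<close>, each multiplied by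
  \<open>G (N div d)\<close>. Replacing every \<open>G (N div d)\<close> by \<open>L\<close> costs
  \<open>O(1)\<close> by Chebyshev's bound, and \<open>T N\<close> is bounded by Abel summation. So
  \<open>L * S N\<close> is bounded.\<close>

lemma S_bounded:
  assumes "L \<noteq> 0"
  shows "\<exists>C. \<forall>N. norm (S N) \<le> C"
proof -
  define T where "T N = (\<Sum>n=1..N. \<chi> n / of_nat n * of_real (ln (real n)))" for N
  \<comment> \<open>The terms before 3 are split off because the weights \<open>ln n / n\<close>
    decrease only from there on.\<close>
  define K where "K = (\<Sum>n=1..<3. norm (\<chi> n / of_nat n * of_real (ln (real n)))) + 2 * M * (ln 3 / 3)"
  have T: "norm (T N) \<le> K" for N
  proof (cases "N \<ge> 3")
    case True
    have eq: "T N = (\<Sum>n=1..<3. \<chi> n / of_nat n * of_real (ln (real n)))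
            + (\<Sum>n=3..<Suc N. \<chi> n * of_real (ln (real n) / real n))"
      unfolding T_def using True sum.atLeastLessThan_concat[of 1 3 "Suc N" "\<lambda>n. \<chi> n / of_nat n * of_real (ln (real n))"]
      by (simp add: atLeastLessThanSuc_atLeastAtMost)
    have "norm (\<Sum>n=3..<Suc N. \<chi> n * of_real (ln (real n) / real n)) \<le> 2 * M * (ln (real 3) / real 3)"
    proof (rule norm_sum_antimono_le)
      show "ln (real (Suc n)) / real (Suc n) \<le> ln (real n) / real n" if "3 \<le> n" for n
        using ln_div_antimono that .
    qed auto
    moreover have "norm (\<Sum>n=1..<3. \<chi> n / of_nat n * of_real (ln (real n))) \<le>
        (\<Sum>n=1..<3. norm (\<chi> n / of_nat n * of_real (ln (real n))))"
      by (rule norm_sum)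
    ultimately show ?thesis unfolding K_def eq
      by (intro order_trans[OF norm_triangle_ineq] add_mono) simp_all
  next
    case False
    have "norm (T N) \<le> (\<Sum>n=1..N. norm (\<chi> n / of_nat n * of_real (ln (real n))))"
      unfolding T_def by (rule norm_sum)
    also have "\<dots> \<le> (\<Sum>n=1..<3. norm (\<chi> n / of_nat n * of_real (ln (real n))))"
      using False by (intro sum_mono2) auto
    also have "\<dots> \<le> K" using M_nonneg by (simp add: K_def)
    finally show ?thesis .
  qed
  have "norm (L * S N - T N) \<le> 8 * M" for N
  proof (cases "N = 0")
    case False
    have "T N = (\<Sum>n=1..N. \<chi> n / of_nat n * of_real (\<Sum>d | d dvd n. mangoldt d))"
      unfolding T_def by (intro sum.cong refl) (subst mangoldt_sum, auto)
    also have "\<dots> = (\<Sum>d=1..N. \<chi> d * of_real (mangoldt d / real d) * G (N div d))"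
      by (rule sum_mult_divisor_sum)
    finally have "L * S N - T N = (\<Sum>d=1..N. \<chi> d * of_real (mangoldt d / real d) * (L - G (N div d)))"
      by (simp only: twisted_mangoldt_sum_def sum_distrib_left right_diff_distrib sum_subtractf mult_ac)
    also have "norm \<dots> \<le> (\<Sum>d=1..N. (2 * M / real N) * mangoldt d)"
    proof (rule sum_norm_le)
      fix d assume d: "d \<in> {1..N}"
      have "norm (\<chi> d * of_real (mangoldt d / real d) * (L - G (N div d))) =
            norm (\<chi> d) * (mangoldt d / real d) * norm (L - G (N div d))"
        using mangoldt_nonneg[of d] by (simp add: norm_mult norm_divide)
      also have "\<dots> \<le> 1 * (mangoldt d / real d) * (2 * M * real d / real N)"
        using d norm_le_1 mangoldt_nonneg[of d] by (intro mult_mono norm_L_diff_div_le) auto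
      also have "\<dots> = (2 * M / real N) * mangoldt d" using d by simp
      finally show "norm (\<chi> d * of_real (mangoldt d / real d) * (L - G (N div d))) \<le> (2 * M / real N) * mangoldt d" .
    qed
    also have "\<dots> = (2 * M / real N) * chebyshev_psi N" by (simp add: chebyshev_psi_def sum_distrib_left)
    also have "\<dots> \<le> (2 * M / real N) * (4 * real N)"
      using M_nonneg by (intro mult_left_mono chebyshev_psi_le) auto
    also have "\<dots> = 8 * M" using False by simp
    finally show ?thesis .
  qed (use M_nonneg in \<open>simp add: twisted_mangoldt_sum_def T_def\<close>)
  hence "norm (L * S N) - norm (T N) \<le> 8 * M" for N
    using norm_triangle_ineq2 order_trans by blast
  hence "norm (L * S N) \<le> 8 * M + K" for N
    using T[of N] by (meson add_mono diff_le_eq order_trans order_refl)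
  hence "norm (S N) \<le> (8 * M + K) / norm L" for N
    using assms by (simp add: norm_mult field_simps)
  thus ?thesis by blast
qed

text \<open>The divisor sum of \<open>moebius d * ln (N / d)\<close> is \<open>mangoldt n\<close>,
  plus \<open>ln N\<close> at \<open>n = 1\<close>, so its twisted sum is the left-hand side. With
  \<open>L = 0\<close> each \<open>G (N div d)\<close> is only a tail, at most
  \<open>2 * M * d / N\<close>, and the sum of \<open>ln (N / d)\<close> is
  \<open>N ln N - ln N!\<close>, at most \<open>N\<close>.\<close>

lemma S_asymptotics_if_L_eq_0:
  assumes "L = 0" "N > 0"
  shows "norm (S N + of_real (ln (real N))) \<le> 2 * M"
proof -
  have "S N + of_real (ln (real N)) =
    (\<Sum>n=1..N. \<chi> n / of_nat n * of_real (\<Sum>d | d dvd n. moebius d * ln (real N / real d)))"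
  proof -
    have "(\<Sum>n=1..N. \<chi> n / of_nat n * of_real (\<Sum>d | d dvd n. moebius d * ln (real N / real d))) =
       (\<Sum>n=1..N. \<chi> n * of_real (mangoldt n / real n) + (if n = 1 then of_real (ln (real N)) else 0))"
    proof (rule sum.cong[OF refl])
      fix n assume n: "n \<in> {1..N}"
      have "(\<Sum>d | d dvd n. moebius d * ln (real N / real d)) =
            (\<Sum>d | d dvd n. ln (real N) * moebius d - moebius d * ln (real d))"
      proof (rule sum.cong[OF refl])
        fix d assume "d \<in> {d. d dvd n}"
        hence "d > 0" using n by (auto intro!: Nat.gr0I)
        thus "moebius d * ln (real N / real d) = ln (real N) * moebius d - moebius d * ln (real d)"
          using assms by (simp add: ln_div algebra_simps)
      qed
      also have "\<dots> = ln (real N) * (if n = 1 then 1 else 0) + mangoldt n"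
        using n moebius_sum[of n] moebius_ln_sum[of n]
        by (simp add: sum_subtractf sum_distrib_left[symmetric])
      finally have eq: "(\<Sum>d | d dvd n. moebius d * ln (real N / real d)) =
        ln (real N) * (if n = 1 then 1 else 0) + mangoldt n" .
      show "\<chi> n / of_nat n * of_real (\<Sum>d | d dvd n. moebius d * ln (real N / real d)) =
        \<chi> n * of_real (mangoldt n / real n) + (if n = 1 then of_real (ln (real N)) else 0)"
        unfolding eq using one by auto
    qed
    also have "\<dots> = S N + of_real (ln (real N))"
      using assms by (simp add: twisted_mangoldt_sum_def sum.distrib sum.delta)
    finally show ?thesis ..
  qed
  also have "\<dots> = (\<Sum>d=1..N. \<chi> d * of_real (moebius d * ln (real N / real d) / real d) * G (N div d))"
    by (rule sum_mult_divisor_sum)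
  also have "norm \<dots> \<le> (\<Sum>d=1..N. (2 * M / real N) * ln (real N / real d))"
  proof (rule sum_norm_le)
    fix d assume d: "d \<in> {1..N}"
    have ln0: "ln (real N / real d) \<ge> 0" using d by simp
    have "norm (\<chi> d * of_real (moebius d * ln (real N / real d) / real d) * G (N div d)) =
          norm (\<chi> d) * (\<bar>moebius d\<bar> * (ln (real N / real d) / real d)) * norm (L - G (N div d))"
      using ln0 assms by (simp only: norm_mult norm_of_real abs_divide abs_mult) simp
    also have "\<dots> \<le> 1 * (1 * (ln (real N / real d) / real d)) * (2 * M * real d / real N)"
      using d norm_le_1 abs_moebius_le[of d] ln0 by (intro mult_mono norm_L_diff_div_le) auto
    also have "\<dots> = (2 * M / real N) * ln (real N / real d)" using d by simp
    finally show "norm (\<chi> d * of_real (moebius d * ln (real N / real d) / real d) * G (N div d))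
       \<le> (2 * M / real N) * ln (real N / real d)" .
  qed
  also have "\<dots> = (2 * M / real N) * (\<Sum>d=1..N. ln (real N) - ln (real d))"
    unfolding sum_distrib_left using assms by (intro sum.cong refl) (auto simp: ln_div)
  also have "(\<Sum>d=1..N. ln (real N) - ln (real d)) = real N * ln (real N) - ln (fact N)"
  proof -
    have "ln (fact N :: real) = (\<Sum>n=1..N. ln (real n))"
      unfolding fact_prod by (subst of_nat_prod, subst ln_prod) auto
    thus ?thesis by (simp add: sum_subtractf)
  qed
  also have "(2 * M / real N) * \<dots> \<le> (2 * M / real N) * real N"
    using M_nonneg ln_fact_ge[of N] by (intro mult_left_mono) auto
  also have "\<dots> = 2 * M" using assms by simp
  finally show ?thesis .
qed

end

section \<open>Non-vanishing for real characters\<close>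

lemma sum_divisors_prime_power_mult:
  fixes f :: "nat \<Rightarrow> 'a::comm_monoid_add" and p m :: nat
  assumes "prime p" "\<not> p dvd m"
  shows "(\<Sum>d | d dvd p ^ k * m. f d) = (\<Sum>i\<le>k. \<Sum>e | e dvd m. f (p ^ i * e))"
proof -
  have p0: "p > 0" using assms by (simp add: prime_gt_0_nat)
  have m0: "m > 0" using assms(2) by (auto intro!: Nat.gr0I)
  have le: "i \<le> j" if "p ^ i * e = p ^ j * e'" "\<not> p dvd e'" for i j e e'
  proof (rule ccontr)
    assume "\<not> i \<le> j"
    hence "j < i" by simp
    then obtain c where c: "i = Suc (j + c)" using less_imp_Suc_add by blast
    have "p ^ j * (p * (p ^ c * e)) = p ^ j * e'" using that c by (simp add: power_add mult_ac)
    hence "e' = p * (p ^ c * e)" using p0 by simp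
    thus False using that by simp
  qed
  have nd: "\<not> p dvd e" if "e dvd m" for e using that assms(2) dvd_trans by blast
  have inj: "inj_on (\<lambda>(i, e). p ^ i * e) ({..k} \<times> {e. e dvd m})"
  proof (rule inj_onI, clarify)
    fix i e j e' assume *: "e dvd m" "e' dvd m" "p ^ i * e = p ^ j * e'"
    have "i = j" using le[OF *(3)] le[OF *(3)[symmetric]] nd *(1,2) by (simp add: antisym)
    thus "i = j \<and> e = e'" using *(3) p0 by simp
  qed
  have im: "(\<lambda>(i, e). p ^ i * e) ` ({..k} \<times> {e. e dvd m}) = {d. d dvd p ^ k * m}"
  proof (intro equalityI subsetI)
    fix d assume "d \<in> {d. d dvd p ^ k * m}"
    then obtain b c where bc: "d = b * c" "b dvd p ^ k" "c dvd m" using division_decomp by blast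
    then obtain i where "i \<le> k" "b = p ^ i" using assms divides_primepow_nat by blast
    thus "d \<in> (\<lambda>(i, e). p ^ i * e) ` ({..k} \<times> {e. e dvd m})" using bc by force
  qed (auto intro!: mult_dvd_mono le_imp_power_dvd)
  have "(\<Sum>d | d dvd p ^ k * m. f d) = (\<Sum>(i, e)\<in>{..k} \<times> {e. e dvd m}. f (p ^ i * e))"
    unfolding im[symmetric] by (subst sum.reindex[OF inj]) (simp add: case_prod_unfold)
  also have "\<dots> = (\<Sum>i\<le>k. \<Sum>e | e dvd m. f (p ^ i * e))"
    by (rule sum.cartesian_product[symmetric])
  finally show ?thesis .
qed

lemma prime_power_cofactor:
  fixes n :: nat
  assumes "n > 1"
  obtains p k m where "prime p" "n = p ^ k * m" "\<not> p dvd m" "0 < m" "m < n"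
proof -
  obtain p where p: "prime p" "p dvd n" using assms by (metis prime_factor_nat less_irrefl)
  from p assms obtain k m where km: "n = p ^ k * m" "\<not> p dvd m" "k > 0"
    by (metis multiplicity_decompose' multiplicity_gt_zero_iff not_gr_zero prime_def prime_elem_def not_less_zero)
  have m: "m > 0" using km by (metis dvd_0_right not_gr_zero)
  have "p ^ k > 1" using km p prime_gt_1_nat one_less_power by blast
  hence "m < n" using km m by simp
  thus ?thesis using that p km m by blast
qed

section \<open>Divisor sums of a real completely multiplicative function\<close>

context
  fixes r :: "nat \<Rightarrow> real"
  assumes r_mult: "\<And>a b. r (a * b) = r a * r b"
    and r_one: "r 1 = 1"
    and r_values: "\<And>n. r n \<in> {-1, 0, 1}"
begin

lemma divisor_sum_prime_power_mult:
  assumes "prime p" "\<not> p dvd m"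
  shows "(\<Sum>d | d dvd p ^ k * m. r d) = (\<Sum>i\<le>k. r p ^ i) * (\<Sum>d | d dvd m. r d)"
proof -
  have r_pow: "r (p ^ i) = r p ^ i" for i using r_one by (induction i) (auto simp: r_mult)
  show ?thesis
    unfolding sum_divisors_prime_power_mult[OF assms] by (simp add: r_mult r_pow sum_product)
qed

lemma geometric_sum_nonneg: "(\<Sum>i\<le>k. r p ^ i) \<ge> 0"
proof -
  consider "r p = -1" | "r p \<ge> 0" using r_values[of p] by auto
  thus ?thesis
  proof cases
    case 1
    have "(\<Sum>i\<le>k. (-1::real) ^ i) = (if even k then 1 else 0)" by (induction k) auto
    thus ?thesis using 1 by simp
  qed (auto intro: sum_nonneg)
qed

lemma geometric_sum_even_ge_1: "(\<Sum>i\<le>2*k. r p ^ i) \<ge> 1"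
proof -
  consider "r p = -1" | "r p \<ge> 0" using r_values[of p] by auto
  thus ?thesis
  proof cases
    case 1
    have "(\<Sum>i\<le>j. (-1::real) ^ i) = (if even j then 1 else 0)" for j by (induction j) auto
    thus ?thesis using 1 by simp
  next
    case 2
    have "(\<Sum>i\<in>{0}. r p ^ i) \<le> (\<Sum>i\<le>2*k. r p ^ i)" using 2 by (intro sum_mono2) auto
    thus ?thesis by simp
  qed
qed

lemma divisor_sum_nonneg: "n > 0 \<Longrightarrow> (\<Sum>d | d dvd n. r d) \<ge> 0"
proof (induction n rule: less_induct)
  case (less n)
  show ?case
  proof (cases "n = 1")
    case True thus ?thesis using r_one by simp
  next
    case False
    with less.prems have "n > 1" by simp
    then obtain p k m where "prime p" "n = p ^ k * m" "\<not> p dvd m" "0 < m" "m < n"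
      by (rule prime_power_cofactor)
    thus ?thesis using less.IH[of m] geometric_sum_nonneg
      by (simp add: divisor_sum_prime_power_mult)
  qed
qed

text \<open>In a square every prime has an even exponent, so each local factor has an odd number of
  terms. It is therefore at least 1 even when the terms alternate in sign.\<close>

lemma divisor_sum_square_ge_1: "j > 0 \<Longrightarrow> (\<Sum>d | d dvd j\<^sup>2. r d) \<ge> 1"
proof (induction j rule: less_induct)
  case (less n)
  show ?case
  proof (cases "n = 1")
    case True thus ?thesis using r_one by simp
  next
    case False
    with less.prems have "n > 1" by simp
    then obtain p k m where pkm: "prime p" "n = p ^ k * m" "\<not> p dvd m" "0 < m" "m < n"
      by (rule prime_power_cofactor)
    have "n\<^sup>2 = p ^ (2 * k) * m\<^sup>2" using pkm by (simp add: power_mult_distrib power_mult[symmetric] mult.commute)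
    moreover have "\<not> p dvd m\<^sup>2" using pkm prime_dvd_power by blast
    ultimately have "(\<Sum>d | d dvd n\<^sup>2. r d) = (\<Sum>i\<le>2*k. r p ^ i) * (\<Sum>d | d dvd m\<^sup>2. r d)"
      using divisor_sum_prime_power_mult[OF pkm(1)] by simp
    moreover have "1 * 1 \<le> (\<Sum>i\<le>2*k. r p ^ i) * (\<Sum>d | d dvd m\<^sup>2. r d)"
      using less.IH[of m] pkm by (intro mult_mono geometric_sum_even_ge_1 order_trans[OF zero_le_one geometric_sum_even_ge_1]) auto
    ultimately show ?thesis by simp
  qed
qed

text \<open>Keeps only the squares of \<open>1, ..., J\<close>; the other terms are
  nonnegative.\<close>

lemma divisor_sum_unbounded: "real J \<le> (\<Sum>n=1..J\<^sup>2. \<Sum>d | d dvd n. r d)"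
proof -
  have "real J = (\<Sum>j=1..J. 1)" by simp
  also have "\<dots> \<le> (\<Sum>j=1..J. \<Sum>d | d dvd j\<^sup>2. r d)"
    by (intro sum_mono divisor_sum_square_ge_1) auto
  also have "\<dots> = (\<Sum>n\<in>(\<lambda>j. j\<^sup>2) ` {1..J}. \<Sum>d | d dvd n. r d)"
    by (subst sum.reindex) (auto simp: inj_on_def)
  also have "\<dots> \<le> (\<Sum>n=1..J\<^sup>2. \<Sum>d | d dvd n. r d)"
    by (intro sum_mono2 divisor_sum_nonneg) (auto simp: power_mono)
  finally show ?thesis .
qed

end

text \<open>
  Monsky's weights \<open>1/(n(1-t)) - t^n/(1-t^n)\<close> compare a Lambert series with the series of
  \<open>L(1)\<close>; their monotonicity is the inequality between arithmetic and geometric means.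
\<close>

definition lambert_weight :: "real \<Rightarrow> nat \<Rightarrow> real" where
  "lambert_weight t n = 1 / (real n * (1 - t)) - t ^ n / (1 - t ^ n)"

text \<open>The terms \<open>u ^ (2 * k + 1)\<close> with \<open>k < n\<close> have geometric mean
  \<open>u ^ n\<close>. The induction goes by two: it strips the outermost pair, bounded by
  \<open>(1 - u ^ Suc n)\<^sup>2 \<ge> 0\<close>, and what remains is \<open>u\<^sup>2\<close> times
  the sum for \<open>n\<close>.\<close>

lemma sum_power_ge:
  fixes u :: real
  assumes "0 < u"
  shows "real n * u ^ n \<le> u * (\<Sum>k<n. (u\<^sup>2) ^ k)"
proof (induction n rule: induct_nat_012)
  case (ge2 n)
  have "(\<Sum>k<Suc (Suc n). (u\<^sup>2) ^ k) = 1 + (\<Sum>k<Suc n. (u\<^sup>2) ^ Suc k)"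
    by (subst sum.lessThan_Suc_shift) simp
  also have "\<dots> = 1 + u\<^sup>2 * (\<Sum>k<n. (u\<^sup>2) ^ k) + (u ^ Suc n)\<^sup>2"
    by (simp add: sum_distrib_left power_mult[symmetric] power_mult_distrib mult.commute)
  finally have "u * (\<Sum>k<Suc (Suc n). (u\<^sup>2) ^ k) =
     u\<^sup>2 * (u * (\<Sum>k<n. (u\<^sup>2) ^ k)) + u * (1 + (u ^ Suc n)\<^sup>2)"
    by (simp add: algebra_simps)
  moreover have "u\<^sup>2 * (real n * u ^ n) \<le> u\<^sup>2 * (u * (\<Sum>k<n. (u\<^sup>2) ^ k))"
    using ge2 by (intro mult_left_mono) auto
  moreover have "u * (2 * u ^ Suc n) \<le> u * (1 + (u ^ Suc n)\<^sup>2)"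
    using assms zero_le_power2[of "1 - u ^ Suc n"] by (intro mult_left_mono) (auto simp: power2_diff)
  ultimately show ?case by (simp add: algebra_simps power2_eq_square)
qed auto

lemma lambert_weight_antimono:
  assumes "0 < t" "t < 1" "n > 0"
  shows "lambert_weight t (Suc n) \<le> lambert_weight t n"
proof -
  \<comment> \<open>Consecutive differences of the two parts of the weight are compared in
    \<open>1\<close> and \<open>2\<close> below, and the claim becomes
    \<open>n (n + 1) t ^ n \<le> s n * s (Suc n)\<close>. It follows by multiplying the mean
    inequalities for \<open>n\<close> and \<open>n + 1\<close>, whose exponents are half-integral in
    \<open>t\<close>, hence the square root.\<close>
  define u where "u = sqrt t"
  have u: "0 < u" "u < 1" "u\<^sup>2 = t" using assms by (auto simp: u_def)
  define s where "s n = (\<Sum>k<n. t ^ k)" for n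
  have s: "1 - t ^ n = (1 - t) * s n" for n
    unfolding s_def by (rule one_diff_power_eq)
  have s_pos: "s n > 0" if "n > 0" for n
    unfolding s_def using that assms by (intro sum_pos) auto
  have sge: "real n * u ^ n \<le> u * s n" for n
    using sum_power_ge[OF u(1), of n] u by (simp add: s_def)
  have "(real n * u ^ n) * (real (Suc n) * u ^ Suc n) \<le> (u * s n) * (u * s (Suc n))"
    using u s_pos[OF assms(3)] by (intro mult_mono sge) auto
  hence "u * (real n * real (Suc n) * t ^ n) \<le> u * (u * (s n * s (Suc n)))"
    unfolding u(3)[symmetric] by (simp add: power_mult[symmetric] mult_ac mult_2 power_add power2_eq_square power_mult_distrib del: of_nat_Suc)
  hence "real n * real (Suc n) * t ^ n \<le> u * (s n * s (Suc n))"
    using u by simp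
  also have "\<dots> \<le> s n * s (Suc n)"
    using u s_pos assms by (intro mult_left_le_one_le) (auto simp: less_imp_le)
  finally have key: "t ^ n / (s n * s (Suc n)) \<le> 1 / (real n * real (Suc n))"
    using s_pos[of n] s_pos[of "Suc n"] assms by (simp add: field_simps del: of_nat_Suc)
  have 1: "t ^ n / (1 - t ^ n) - t ^ Suc n / (1 - t ^ Suc n) = t ^ n / (s n * s (Suc n)) / (1 - t)"
  proof -
    have "t ^ n / (1 - t ^ n) - t ^ Suc n / (1 - t ^ Suc n) =
          (t ^ n * s (Suc n) - t ^ Suc n * s n) / ((1 - t) * (s n * s (Suc n)))"
    proof -
      have "a / (w * x) - b / (w * y) = (a * y - b * x) / (w * (x * y))"
        if "w > 0" "x > 0" "y > 0" for w x y a b :: real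
        using that by (simp add: field_simps)
      thus ?thesis unfolding s using s_pos[of n] s_pos[of "Suc n"] assms by simp
    qed
    also have "t ^ n * s (Suc n) - t ^ Suc n * s n = t ^ n"
    proof -
      have "s (Suc n) = 1 + t * s n" unfolding s_def by (subst sum.lessThan_Suc_shift) (simp add: sum_distrib_left)
      thus ?thesis by (simp add: algebra_simps)
    qed
    finally show ?thesis by (simp add: mult_ac)
  qed
  have 2: "1 / (real n * (1 - t)) - 1 / (real (Suc n) * (1 - t)) = 1 / (real n * real (Suc n)) / (1 - t)"
  proof -
    have "1 / (a * w) - 1 / ((1 + a) * w) = 1 / (a * (1 + a)) / w" if "a > 0" "w > 0" for a w :: real
      using that by (simp add: divide_simps)
    thus ?thesis using assms by simp
  qed
  have "t ^ n / (s n * s (Suc n)) / (1 - t) \<le> 1 / (real n * real (Suc n)) / (1 - t)"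
    using key assms by (intro divide_right_mono) auto
  thus ?thesis using 1 2 by (simp add: lambert_weight_def)
qed

lemma lambert_weight_nonneg:
  assumes "0 < t" "t < 1" "n > 0"
  shows "lambert_weight t n \<ge> 0"
proof -
  have "real n * t ^ n = (\<Sum>k<n. t ^ n)" by simp
  also have "\<dots> \<le> (\<Sum>k<n. t ^ k)" using assms by (intro sum_mono power_decreasing) auto
  finally have "real n * t ^ n * (1 - t) \<le> (1 - t) * (\<Sum>k<n. t ^ k)" using assms by (simp add: mult.commute)
  also have "\<dots> = 1 - t ^ n" by (rule one_diff_power_eq[symmetric])
  finally have "real n * t ^ n * (1 - t) \<le> 1 - t ^ n" .
  moreover have "t ^ n < 1" using assms by (simp add: power_less_one_iff)
  moreover have "b / c \<le> 1 / a" if "b * a \<le> c" "a > 0" "c > 0" for a b c :: real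
    using that by (simp add: field_simps)
  ultimately have "t ^ n / (1 - t ^ n) \<le> 1 / (real n * (1 - t))" using assms by (simp add: mult_ac)
  thus ?thesis by (simp add: lambert_weight_def)
qed

lemma lambert_weight_1: "0 < t \<Longrightarrow> t < 1 \<Longrightarrow> lambert_weight t (Suc 0) = 1"
  by (simp add: lambert_weight_def field_simps)

text \<open>The Lambert series of \<open>r\<close> is the power series with coefficients
  \<open>a n\<close>. It equals \<open>L / (1 - t)\<close> minus the series of
  \<open>r d * lambert_weight t d\<close>, and Abel summation bounds the latter by
  \<open>2 * M\<close> for all \<open>t < 1\<close>, since the first weight is 1. If
  \<open>L = 0\<close>, letting \<open>t\<close> tend to 1 bounds the sums of the
  \<open>a n\<close>, which however exceed every bound along squares.\<close>

lemma (in bounded_character) L_nonzero_if_real: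
  assumes real: "\<And>n. \<chi> n \<in> {-1, 0, 1}"
  shows "L \<noteq> 0"
proof
  assume L0: "L = 0"
  define r where "r n = Re (\<chi> n)" for n
  have chi_r: "\<chi> n = of_real (r n)" for n using real[of n] by (auto simp: r_def)
  have r_mult: "r (a * b) = r a * r b" for a b
    using mult[of a b] unfolding chi_r by (simp flip: of_real_mult)
  have r_one: "r 1 = 1" using one by (simp add: r_def)
  have r_values: "r n \<in> {-1, 0, 1}" for n using real[of n] by (auto simp: r_def)
  have r_abs: "\<bar>r n\<bar> \<le> 1" for n using r_values[of n] by auto
  define a where "a n = (\<Sum>d | d dvd n. r d)" for n
  have a_nonneg: "a n \<ge> 0" if "n > 0" for n
    unfolding a_def by (rule divisor_sum_nonneg[OF r_mult r_one r_values that])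
  have bound_N: "(\<Sum>n=1..N. a n * t ^ n) \<le> 2 * M / real (Suc N) / (1 - t) + 2 * M + real N * t ^ N / (1 - t)"
    if t: "0 < t" "t < 1" for t :: real and N
  proof -
    \<comment> \<open>The tail, beyond \<open>k = N div d\<close>, of the geometric series in
      \<open>t ^ d\<close>.\<close>
    define err where "err d = t ^ (d * Suc (N div d)) / (1 - t ^ d)" for d
    have "(\<Sum>n=1..N. a n * t ^ n) = (\<Sum>n=1..N. \<Sum>d | d dvd n. r d * t ^ (d * (n div d)))"
      unfolding a_def sum_distrib_right by (intro sum.cong refl) auto
    also have "\<dots> = (\<Sum>d=1..N. \<Sum>k=1..N div d. r d * t ^ (d * k))"
      by (rule sum_divisors_swap)
    also have "\<dots> = (\<Sum>d=1..N. r d * (1 / real d) / (1 - t) - r d * lambert_weight t d - r d * err d)"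
    proof (rule sum.cong[OF refl])
      fix d assume d: "d \<in> {1..N}"
      have td: "t ^ d < 1" using t d by (simp add: power_less_one_iff)
      have "(1 - x) * (\<Sum>k=1..K. x ^ k) = x - x ^ Suc K" for x :: real and K
      proof (induction K)
        case (Suc K)
        have "(1 - x) * (\<Sum>k=1..Suc K. x ^ k) = (1 - x) * (\<Sum>k=1..K. x ^ k) + (1 - x) * x ^ Suc K"
          by (simp add: distrib_left)
        also have "\<dots> = x - x ^ Suc (Suc K)" unfolding Suc by (simp add: algebra_simps)
        finally show ?case .
      qed simp
      hence "(\<Sum>k=1..K. (t ^ d) ^ k) = (t ^ d - (t ^ d) ^ Suc K) / (1 - t ^ d)" for K
        using td by (metis diff_gt_0_iff_gt less_irrefl nonzero_mult_div_cancel_left)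
      hence "(\<Sum>k=1..N div d. r d * t ^ (d * k)) = r d * (t ^ d / (1 - t ^ d) - err d)"
        by (simp only: sum_distrib_left[symmetric] power_mult err_def diff_divide_distrib)
      also have "t ^ d / (1 - t ^ d) = 1 / real d / (1 - t) - lambert_weight t d"
        using d t by (simp add: lambert_weight_def)
      finally show "(\<Sum>k=1..N div d. r d * t ^ (d * k)) =
          r d * (1 / real d) / (1 - t) - r d * lambert_weight t d - r d * err d"
        by (simp add: algebra_simps)
    qed
    also have "\<dots> = Re (G N) / (1 - t) - (\<Sum>d=1..N. r d * lambert_weight t d) - (\<Sum>d=1..N. r d * err d)"
      by (simp add: G_def r_def sum_subtractf sum_divide_distrib Re_divide_of_nat)
    also have "\<dots> \<le> 2 * M / real (Suc N) / (1 - t) + 2 * M + real N * t ^ N / (1 - t)"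
    proof -
      have "Re (G N) \<le> norm (G N)" by (rule complex_Re_le_cmod)
      also have "\<dots> \<le> 2 * M / real (Suc N)" using norm_L_diff_le[of N] L0 by simp
      finally have 1: "Re (G N) / (1 - t) \<le> 2 * M / real (Suc N) / (1 - t)"
        using t by (intro divide_right_mono) auto
      have "- (\<Sum>d=1..N. r d * lambert_weight t d) \<le> norm (\<Sum>d=1..<Suc N. \<chi> d * of_real (lambert_weight t d))"
        unfolding chi_r atLeastLessThanSuc_atLeastAtMost of_real_mult[symmetric] of_real_sum[symmetric] norm_of_real by simp
      also have "\<dots> \<le> 2 * M * lambert_weight t 1"
        using t by (intro norm_sum_antimono_le) (auto intro!: lambert_weight_antimono lambert_weight_nonneg)
      finally have 2: "- (\<Sum>d=1..N. r d * lambert_weight t d) \<le> 2 * M"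
        using t by (simp add: lambert_weight_1)
      have "- (\<Sum>d=1..N. r d * err d) \<le> (\<Sum>d=1..N. t ^ N / (1 - t))"
        unfolding sum_negf[symmetric]
      proof (rule sum_mono)
        fix d assume d: "d \<in> {1..N}"
        have td: "t ^ d \<le> t" using t d power_decreasing[of 1 d t] by simp
        have "N < d * Suc (N div d)" using d by (metis atLeastAtMost_iff dividend_less_times_div mult_Suc_right less_le_trans zero_less_one)
        hence "t ^ (d * Suc (N div d)) \<le> t ^ N" using t by (intro power_decreasing) auto
        hence err: "err d \<le> t ^ N / (1 - t)" "err d \<ge> 0" unfolding err_def using t td by (auto intro!: frac_le)
        have "- (r d * err d) \<le> \<bar>r d\<bar> * err d" using err by (metis abs_ge_minus_self abs_mult abs_of_nonneg)
        also have "\<dots> \<le> 1 * err d" using r_abs err by (intro mult_right_mono) auto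
        finally show "- (r d * err d) \<le> t ^ N / (1 - t)" using err by simp
      qed
      hence 3: "- (\<Sum>d=1..N. r d * err d) \<le> real N * t ^ N / (1 - t)" by simp
      show ?thesis using 1 2 3 by linarith
    qed
    finally show ?thesis .
  qed
  \<comment> \<open>For fixed \<open>t\<close> and \<open>K\<close> the bound for
    \<open>N \<ge> K\<close> is passed to the limit in \<open>N\<close>, which removes both
    truncation errors.\<close>
  have bound_t: "(\<Sum>n=1..K. a n * t ^ n) \<le> 2 * M" if t: "0 < t" "t < 1" for t :: real and K
  proof (rule LIMSEQ_le_const)
    have "(\<lambda>N. 2 * M / real (Suc N) / (1 - t) + 2 * M + real N * t ^ N / (1 - t)) \<longlonglongrightarrow> 0 / (1 - t) + 2 * M + 0 / (1 - t)"
    proof (intro tendsto_intros)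
      show "(\<lambda>N. 2 * M / real (Suc N)) \<longlonglongrightarrow> 0"
        using tendsto_mult_right_zero[OF LIMSEQ_inverse_real_of_nat, of "2 * M"]
        by (simp add: divide_inverse)
      show "(\<lambda>N. real N * t ^ N) \<longlonglongrightarrow> 0" using t by (intro powser_times_n_limit_0) auto
    qed (use t in auto)
    thus "(\<lambda>N. 2 * M / real (Suc N) / (1 - t) + 2 * M + real N * t ^ N / (1 - t)) \<longlonglongrightarrow> 2 * M" by simp
    have "(\<Sum>n=1..K. a n * t ^ n) \<le> (\<Sum>n=1..N. a n * t ^ n)" if "N \<ge> K" for N
      using that t a_nonneg by (intro sum_mono2) auto
    thus "\<exists>N0. \<forall>N\<ge>N0. (\<Sum>n=1..K. a n * t ^ n) \<le> 2 * M / real (Suc N) / (1 - t) + 2 * M + real N * t ^ N / (1 - t)"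
      using bound_N[OF t] order_trans by blast
  qed
  have bound: "(\<Sum>n=1..K. a n) \<le> 2 * M" for K
  proof (rule LIMSEQ_le_const2)
    \<comment> \<open>Now \<open>t\<close> tends to 1 along the sequence
      \<open>(j + 1) / (j + 2)\<close>, which lies strictly between 0 and 1.\<close>
    have "(\<lambda>j. \<Sum>n=1..K. a n * (real (Suc j) / real (Suc (Suc j))) ^ n) \<longlonglongrightarrow> (\<Sum>n=1..K. a n * 1 ^ n)"
      using LIMSEQ_Suc[OF LIMSEQ_n_over_Suc_n] by (intro tendsto_intros)
    thus "(\<lambda>j. \<Sum>n=1..K. a n * (real (Suc j) / real (Suc (Suc j))) ^ n) \<longlonglongrightarrow> (\<Sum>n=1..K. a n)" by simp
    show "\<exists>N. \<forall>j\<ge>N. (\<Sum>n=1..K. a n * (real (Suc j) / real (Suc (Suc j))) ^ n) \<le> 2 * M"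
      by (intro exI allI impI bound_t) auto
  qed
  obtain J :: nat where "2 * M < real J" using reals_Archimedean2 by blast
  moreover have "real J \<le> (\<Sum>n=1..J\<^sup>2. a n)"
    unfolding a_def by (rule divisor_sum_unbounded[OF r_mult r_one r_values])
  ultimately show False using bound[of "J\<^sup>2"] by linarith
qed

section \<open>Dirichlet characters\<close>

text \<open>The characters of the unit group modulo \<open>m\<close>, extended by zero and lifted to
  the naturals.\<close>

definition dirichlet_characters :: "nat \<Rightarrow> (nat \<Rightarrow> complex) set" where
  "dirichlet_characters m = {\<chi>. (\<forall>a b. \<chi> (a * b) = \<chi> a * \<chi> b) \<and> \<chi> 1 = 1 \<and>
     (\<forall>n. \<chi> n \<noteq> 0 \<longleftrightarrow> coprime n m) \<and> (\<forall>n. \<chi> (n mod m) = \<chi> n)}"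

definition principal_character :: "nat \<Rightarrow> nat \<Rightarrow> complex" where
  "principal_character m n = (if coprime n m then 1 else 0)"

context
  fixes m :: nat
  assumes m_pos: "m > 0"
begin

lemma totient_m_pos: "totient m > 0"
  using m_pos by simp

lemma dirichlet_characterD:
  assumes "\<chi> \<in> dirichlet_characters m"
  shows "\<chi> (a * b) = \<chi> a * \<chi> b" "\<chi> 1 = 1" "\<chi> n \<noteq> 0 \<longleftrightarrow> coprime n m" "\<chi> (n mod m) = \<chi> n"
  using assms by (auto simp: dirichlet_characters_def)

lemma dirichlet_character_power:
  assumes "\<chi> \<in> dirichlet_characters m"
  shows "\<chi> (a ^ k) = \<chi> a ^ k"
  using dirichlet_characterD[OF assms] by (induction k) auto

lemma dirichlet_character_cong:
  assumes "\<chi> \<in> dirichlet_characters m" "[a = b] (mod m)"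
  shows "\<chi> a = \<chi> b"
  using dirichlet_characterD(4)[OF assms(1)] assms(2) unfolding cong_def by metis

lemma dirichlet_character_root_of_unity:
  assumes "\<chi> \<in> dirichlet_characters m" "coprime n m"
  shows "\<chi> n ^ totient m = 1"
proof -
  have "[n ^ totient m = 1] (mod m)" using assms by (intro euler_theorem)
  hence "\<chi> (n ^ totient m) = \<chi> 1" by (rule dirichlet_character_cong[OF assms(1)])
  thus ?thesis using dirichlet_character_power[OF assms(1)] dirichlet_characterD(2)[OF assms(1)] by simp
qed

lemma norm_dirichlet_character:
  assumes "\<chi> \<in> dirichlet_characters m"
  shows "norm (\<chi> n) = (if coprime n m then 1 else 0)"
proof (cases "coprime n m")
  case True
  have "norm (\<chi> n) ^ totient m = 1"
    using dirichlet_character_root_of_unity[OF assms True] by (metis norm_one norm_power)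
  hence "norm (\<chi> n) = 1"
    using totient_m_pos power_eq_imp_eq_base[of "norm (\<chi> n)" "totient m" 1] by simp
  thus ?thesis using True by simp
qed (use dirichlet_characterD(3)[OF assms] in auto)

lemma cnj_mult_dirichlet_character:
  assumes "\<chi> \<in> dirichlet_characters m"
  shows "cnj (\<chi> n) * \<chi> n = (if coprime n m then 1 else 0)"
  using norm_dirichlet_character[OF assms, of n] complex_norm_square[of "\<chi> n"]
  by (simp add: mult.commute split: if_splits)

lemma principal_character_in: "principal_character m \<in> dirichlet_characters m"
  by (auto simp: dirichlet_characters_def principal_character_def coprime_mult_left_iff coprime_mod_left_iff m_pos)

lemma dirichlet_characters_mult:
  assumes "\<chi> \<in> dirichlet_characters m" "\<psi> \<in> dirichlet_characters m"
  shows "(\<lambda>n. \<chi> n * \<psi> n) \<in> dirichlet_characters m"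
  using assms by (auto simp: dirichlet_characters_def)

lemma dirichlet_characters_cnj:
  assumes "\<chi> \<in> dirichlet_characters m"
  shows "(\<lambda>n. cnj (\<chi> n)) \<in> dirichlet_characters m"
  using assms by (auto simp: dirichlet_characters_def)

lemma finite_dirichlet_characters: "finite (dirichlet_characters m)"
proof -
  define V where "V = insert 0 {z::complex. z ^ totient m = 1}"
  have "finite V" unfolding V_def using totient_m_pos by (simp add: finite_roots_unity Suc_le_eq)
  hence "finite ((\<lambda>f n. f (n mod m)) ` ({..<m} \<rightarrow>\<^sub>E V))" by (intro finite_imageI finite_PiE) auto
  moreover have "dirichlet_characters m \<subseteq> (\<lambda>f n. f (n mod m)) ` ({..<m} \<rightarrow>\<^sub>E V)"
  proof
    fix \<chi> assume \<chi>: "\<chi> \<in> dirichlet_characters m"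
    have "\<chi> n \<in> V" for n
      using dirichlet_character_root_of_unity[OF \<chi>] dirichlet_characterD(3)[OF \<chi>, of n] by (auto simp: V_def)
    hence "restrict \<chi> {..<m} \<in> {..<m} \<rightarrow>\<^sub>E V" by auto
    moreover have "\<chi> = (\<lambda>n. restrict \<chi> {..<m} (n mod m))"
      using m_pos dirichlet_characterD(4)[OF \<chi>] by auto
    ultimately show "\<chi> \<in> (\<lambda>f n. f (n mod m)) ` ({..<m} \<rightarrow>\<^sub>E V)" by blast
  qed
  ultimately show ?thesis by (rule finite_subset[rotated])
qed

text \<open>Multiplication by a unit \<open>h\<close> with \<open>\<chi> h \<noteq> 1\<close>
  permutes the residues and multiplies the sum by \<open>\<chi> h\<close>.\<close>

lemma sum_dirichlet_character_eq_0:
  assumes \<chi>: "\<chi> \<in> dirichlet_characters m" and "\<chi> \<noteq> principal_character m"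
  shows "(\<Sum>n<m. \<chi> n) = 0"
proof -
  obtain h where "\<chi> h \<noteq> principal_character m h" using assms by blast
  hence h: "coprime h m" "\<chi> h \<noteq> 1"
    using dirichlet_characterD(3)[OF \<chi>, of h] by (auto simp: principal_character_def split: if_splits)
  have inj: "inj_on (\<lambda>n. h * n mod m) {..<m}"
  proof (rule inj_onI)
    fix a b assume "a \<in> {..<m}" "b \<in> {..<m}" "h * a mod m = h * b mod m"
    hence "[h * a = h * b] (mod m)" by (simp add: cong_def)
    hence "[a = b] (mod m)" using cong_mult_lcancel_nat[OF h(1)] by blast
    thus "a = b" using \<open>a \<in> _\<close> \<open>b \<in> _\<close> by (simp add: cong_def)
  qed
  have "(\<lambda>n. h * n mod m) ` {..<m} = {..<m}"
    by (rule card_subset_eq) (use m_pos inj in \<open>auto simp: card_image\<close>)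
  hence "(\<Sum>n<m. \<chi> n) = (\<Sum>n<m. \<chi> (h * n mod m))"
    using sum.reindex[OF inj, of \<chi>] by simp
  also have "\<dots> = \<chi> h * (\<Sum>n<m. \<chi> n)"
    by (simp only: dirichlet_characterD(4)[OF \<chi>] dirichlet_characterD(1)[OF \<chi>] sum_distrib_left)
  finally show ?thesis using h by (metis mult_cancel_right2)
qed

lemma nonprincipal_bounded_character:
  assumes \<chi>: "\<chi> \<in> dirichlet_characters m" and "\<chi> \<noteq> principal_character m"
  shows "bounded_character \<chi> (real m + 1)"
proof
  show "\<chi> (a * b) = \<chi> a * \<chi> b" "\<chi> 1 = 1" for a b using dirichlet_characterD[OF \<chi>] by auto
  show le1: "norm (\<chi> n) \<le> 1" for n using norm_dirichlet_character[OF \<chi>] by simp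
  have bound: "norm (\<Sum>n<N. \<chi> n) \<le> real m" for N
  proof (induction N rule: less_induct)
    case (less N)
    show ?case
    proof (cases "N < m")
      case True
      have "norm (\<Sum>n<N. \<chi> n) \<le> (\<Sum>n<N. 1)" by (intro sum_norm_le le1)
      thus ?thesis using True by simp
    next
      case False
      then obtain k where k: "N = m + k" using le_Suc_ex not_less by blast
      have "(\<Sum>n<m+k. \<chi> n) = (\<Sum>n<m. \<chi> n) + (\<Sum>n<k. \<chi> (m + n))"
        by (induction k) (auto simp: algebra_simps)
      also have "(\<Sum>n<k. \<chi> (m + n)) = (\<Sum>n<k. \<chi> n)"
        by (intro sum.cong refl dirichlet_character_cong[OF \<chi>]) (simp add: cong_def)
      finally show ?thesis
        using less[of k] k m_pos sum_dirichlet_character_eq_0[OF assms] by simp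
    qed
  qed
  \<comment> \<open>Periods are summed from 0 but the locale sums from 1; the term
    \<open>\<chi> 0\<close> accounts for the additional 1.\<close>
  show "norm (\<Sum>n=1..N. \<chi> n) \<le> real m + 1" for N
  proof -
    have "(\<Sum>n<Suc N. \<chi> n) = \<chi> 0 + (\<Sum>n=1..N. \<chi> n)"
      by (simp add: lessThan_Suc_atMost atMost_atLeast0 sum.atLeast_Suc_atMost)
    hence eq: "(\<Sum>n=1..N. \<chi> n) = (\<Sum>n<Suc N. \<chi> n) - \<chi> 0" by simp
    show ?thesis unfolding eq
      by (intro order_trans[OF norm_triangle_ineq4] add_mono bound le1)
  qed
qed

text \<open>Otherwise a nonzero polynomial of degree below \<open>K\<close> would vanish at all
  \<open>K\<close> roots of unity. This is what guarantees a nonzero projection onto some eigenspace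
  of a translation of order dividing \<open>K\<close>.\<close>

lemma exists_root_of_unity_sum_nonzero:
  fixes x :: "nat \<Rightarrow> complex"
  assumes "K > 0" "x 0 \<noteq> 0"
  shows "\<exists>w. w ^ K = 1 \<and> (\<Sum>k<K. w ^ k * x k) \<noteq> 0"
proof (rule ccontr)
  assume contra: "\<not> ?thesis"
  define p where "p = (\<Sum>k<K. Polynomial.monom (x k) k)"
  have coeff: "Polynomial.coeff p i = (if i < K then x i else 0)" for i
    by (simp add: p_def coeff_sum)
  have p0: "p \<noteq> 0" using coeff[of 0] assms by auto
  have "Polynomial.degree p \<le> K - 1" using coeff assms(1) by (intro degree_le) auto
  hence "Polynomial.degree p < K" using assms(1) by simp
  have "poly p w = (\<Sum>k<K. w ^ k * x k)" for w
    by (simp add: p_def poly_sum poly_monom mult.commute)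
  hence "{w. w ^ K = 1} \<subseteq> {w. poly p w = 0}" using contra by auto
  hence "card {w::complex. w ^ K = 1} \<le> card {w. poly p w = 0}"
    using p0 by (intro card_mono poly_roots_finite)
  also have "\<dots> \<le> Polynomial.degree p" by (rule card_poly_roots_bound[OF p0])
  finally show False using \<open>Polynomial.degree p < K\<close> card_roots_unity_eq[of K] assms by simp
qed

text \<open>
  A character not trivial at \<open>g\<close> is a common eigenfunction of all translations \<open>n \<mapsto> h * n\<close>
  lying in the invariant space of functions whose sums over the orbits of \<open>g\<close> vanish.
\<close>

lemma exists_common_eigenfunction:
  assumes g: "coprime g m" "\<not> [g = 1] (mod m)"
    and "finite H" "H \<subseteq> {h. coprime h m}"
  shows "\<exists>f :: nat \<Rightarrow> complex. (\<forall>n. f (n mod m) = f n) \<and> (\<forall>n. (\<Sum>k<totient m. f (g ^ k * n)) = 0) \<and>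
     (\<exists>n. coprime n m \<and> f n \<noteq> 0) \<and> (\<forall>h\<in>H. \<exists>c. \<forall>n. f (h * n) = c * f n)"
  using assms(3,4)
proof (induction H rule: finite_induct)
  case empty
  define d :: "nat \<Rightarrow> complex" where "d n = (if [n = 1] (mod m) then 1 else 0)" for n
  have d_cong: "d a = d b" if "[a = b] (mod m)" for a b
    using that unfolding d_def by (metis cong_sym cong_trans)
  \<comment> \<open>Along an orbit of \<open>g\<close> this difference telescopes to 0 by Euler's
    theorem, while \<open>f 1 = 1\<close> because \<open>g\<close> is not 1 modulo
    \<open>m\<close>.\<close>
  define f where "f n = d n - d (g * n)" for n
  have "f (n mod m) = f n" for n
    unfolding f_def by (intro arg_cong2[where f = "(-)"] d_cong) (simp_all add: cong_def mod_mult_right_eq)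
  moreover have "(\<Sum>k<totient m. f (g ^ k * n)) = 0" for n
  proof -
    have "(\<Sum>k<K. f (g ^ k * n)) = d n - d (g ^ K * n)" for K
      by (induction K) (auto simp: f_def mult_ac)
    moreover have "[g ^ totient m * n = 1 * n] (mod m)"
      using g(1) by (intro cong_mult euler_theorem) auto
    hence "d (g ^ totient m * n) = d (1 * n)" by (rule d_cong)
    ultimately show ?thesis by simp
  qed
  moreover have "coprime 1 m \<and> f 1 \<noteq> 0" using g by (simp add: f_def d_def)
  ultimately show ?case by blast
next
  case (insert h H)
  let ?K = "totient m"
  from insert.prems have "H \<subseteq> {h. coprime h m}" by simp
  from insert.IH[OF this] obtain f :: "nat \<Rightarrow> complex" where
    f: "(\<forall>n. f (n mod m) = f n) \<and> (\<forall>n. (\<Sum>k<?K. f (g ^ k * n)) = 0) \<and>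
       (\<exists>n. coprime n m \<and> f n \<noteq> 0) \<and> (\<forall>h\<in>H. \<exists>c. \<forall>n. f (h * n) = c * f n)" ..
  have per: "f (n mod m) = f n" for n using f by blast
  have orb: "(\<Sum>k<?K. f (g ^ k * n)) = 0" for n using f by blast
  have eig: "\<exists>c. \<forall>n. f (h * n) = c * f n" if "h \<in> H" for h using f that by blast
  from f obtain n0 where n0: "coprime n0 m" "f n0 \<noteq> 0" by blast
  have f_cong: "f a = f b" if "[a = b] (mod m)" for a b
    using per that unfolding cong_def by metis
  \<comment> \<open>The sum \<open>f'\<close> is, up to a factor, the projection of \<open>f\<close>
    onto the eigenspace of translation by \<open>h\<close> with eigenvalue \<open>1/w\<close>;
    \<open>w\<close> is chosen so that it survives at \<open>n0\<close>. Translations commute, so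
    the orbit condition and the earlier eigenvalue equations are inherited.\<close>
  obtain w where w: "w ^ ?K = 1" "(\<Sum>k<?K. w ^ k * f (h ^ k * n0)) \<noteq> 0"
    using exists_root_of_unity_sum_nonzero[of ?K "\<lambda>k. f (h ^ k * n0)"] totient_m_pos n0 by auto
  define f' where "f' n = (\<Sum>k<?K. w ^ k * f (h ^ k * n))" for n
  have "f' (n mod m) = f' n" for n
    unfolding f'_def by (intro sum.cong refl arg_cong2[where f = "(*)"] f_cong) (simp add: cong_def mod_mult_right_eq)
  moreover have "(\<Sum>k<?K. f' (g ^ k * n)) = 0" for n
  proof -
    have "(\<Sum>k<?K. f' (g ^ k * n)) = (\<Sum>j<?K. \<Sum>k<?K. w ^ j * f (g ^ k * (h ^ j * n)))"
      unfolding f'_def by (subst sum.swap) (simp add: mult_ac)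
    also have "\<dots> = 0" by (simp add: sum_distrib_left[symmetric] orb)
    finally show ?thesis .
  qed
  moreover have "coprime n0 m \<and> f' n0 \<noteq> 0" using n0 w by (simp add: f'_def)
  moreover have "\<exists>c. \<forall>n. f' (h' * n) = c * f' n" if h': "h' \<in> insert h H" for h'
  proof (cases "h' \<in> H")
    case True
    then obtain c where c: "\<And>n. f (h' * n) = c * f n" using eig by blast
    have "f' (h' * n) = c * f' n" for n
    proof -
      have "f (h ^ k * (h' * n)) = c * f (h ^ k * n)" for k
        using c[of "h ^ k * n"] by (simp add: mult_ac)
      thus ?thesis by (simp add: f'_def sum_distrib_left mult_ac)
    qed
    thus ?thesis by blast
  next
    case False
    hence [simp]: "h' = h" using h' by simp
    have w0: "w \<noteq> 0" using w(1) totient_m_pos by (auto simp: power_0_left)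
    have "w * f' (h * n) = f' n" for n
    proof -
      have "w * f' (h * n) = (\<Sum>k<?K. w ^ Suc k * f (h ^ Suc k * n))"
        by (simp add: f'_def sum_distrib_left mult_ac)
      also have "\<dots> + w ^ 0 * f (h ^ 0 * n) = (\<Sum>k<Suc ?K. w ^ k * f (h ^ k * n))"
        by (subst sum.lessThan_Suc_shift) simp
      also have "\<dots> = f' n + f (h ^ ?K * n)" using w by (simp add: f'_def)
      also have "f (h ^ ?K * n) = f (1 * n)"
        using insert.prems by (intro f_cong cong_mult euler_theorem) auto
      finally show ?thesis by simp
    qed
    hence "f' (h' * n) = inverse w * f' n" for n
    proof -
      have "f' (h' * n) = inverse w * (w * f' (h * n))" using w0 by simp
      thus ?thesis unfolding \<open>\<And>n. w * f' (h * n) = f' n\<close> .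
    qed
    thus ?thesis by blast
  qed
  ultimately show ?case by blast
qed

text \<open>A common eigenfunction for all units satisfies
  \<open>f (a * b) * f 1 = f a * f b\<close>, so \<open>f / f 1\<close> is a character. If it were 1
  at \<open>g\<close>, the orbit sum at 1 would be \<open>totient m * f 1\<close>, which is not
  0.\<close>

lemma exists_separating_character:
  assumes g: "coprime g m" "\<not> [g = 1] (mod m)"
  shows "\<exists>\<chi>\<in>dirichlet_characters m. \<chi> g \<noteq> 1"
proof -
  let ?H = "{h. h < m \<and> coprime h m}" and ?K = "totient m"
  have "finite ?H" "?H \<subseteq> {h. coprime h m}" by auto
  from exists_common_eigenfunction[OF g this] obtain f :: "nat \<Rightarrow> complex" where
    f: "(\<forall>n. f (n mod m) = f n) \<and> (\<forall>n. (\<Sum>k<?K. f (g ^ k * n)) = 0) \<and>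
       (\<exists>n. coprime n m \<and> f n \<noteq> 0) \<and> (\<forall>h\<in>?H. \<exists>c. \<forall>n. f (h * n) = c * f n)" ..
  have per: "f (n mod m) = f n" for n using f by blast
  have orb: "(\<Sum>k<?K. f (g ^ k * n)) = 0" for n using f by blast
  have eig: "\<exists>c. \<forall>n. f (h * n) = c * f n" if "h \<in> ?H" for h using f that by blast
  from f obtain n0 where n0: "coprime n0 m" "f n0 \<noteq> 0" by blast
  have f_cong: "f a = f b" if "[a = b] (mod m)" for a b
    using per that unfolding cong_def by metis
  have eig': "\<exists>c. \<forall>n. f (h * n) = c * f n" if h: "coprime h m" for h
  proof -
    obtain c where c: "\<And>n. f ((h mod m) * n) = c * f n"
      using eig[of "h mod m"] h m_pos by (auto simp: coprime_mod_left_iff)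
    have "f (h * n) = f ((h mod m) * n)" for n by (intro f_cong) (simp add: cong_def mod_mult_left_eq)
    thus ?thesis using c by auto
  qed
  have f1: "f 1 \<noteq> 0"
  proof
    obtain c where "f (n0 * 1) = c * f 1" using eig'[OF n0(1)] by blast
    moreover assume "f 1 = 0"
    ultimately show False using n0(2) by simp
  qed
  have fmult: "f (a * b) * f 1 = f a * f b" if a: "coprime a m" for a b
  proof -
    obtain c where "\<And>n. f (a * n) = c * f n" using eig'[OF a] by blast
    from this[of b] this[of 1] show ?thesis by simp
  qed
  have fpow: "f (a ^ k) * f 1 ^ k = f a ^ k * f 1" if "coprime a m" for a k
  proof (induction k)
    case (Suc k)
    have "f (a ^ Suc k) * f 1 ^ Suc k = (f (a * a ^ k) * f 1) * f 1 ^ k" by (simp add: mult_ac)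
    also have "\<dots> = f a * (f (a ^ k) * f 1 ^ k)" unfolding fmult[OF that] by (rule mult.assoc)
    also have "\<dots> = f a ^ Suc k * f 1" unfolding Suc by simp
    finally show ?case .
  qed simp
  have f_nz: "f a \<noteq> 0" if "coprime a m" for a
  proof
    assume "f a = 0"
    moreover have "f (a ^ ?K) = f 1" using that by (intro f_cong euler_theorem)
    ultimately show False using fpow[OF that, of ?K] f1 totient_m_pos by (simp add: power_0_left)
  qed
  define \<chi> where "\<chi> n = (if coprime n m then f n / f 1 else 0)" for n
  have "\<chi> \<in> dirichlet_characters m"
    unfolding dirichlet_characters_def
  proof (intro CollectI conjI allI)
    show "\<chi> (a * b) = \<chi> a * \<chi> b" for a b
      using fmult[of a b] f1 by (auto simp: \<chi>_def coprime_mult_left_iff field_simps)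
    show "\<chi> 1 = 1" using f1 by (simp add: \<chi>_def)
    show "\<chi> n \<noteq> 0 \<longleftrightarrow> coprime n m" for n using f1 f_nz by (simp add: \<chi>_def)
    show "\<chi> (n mod m) = \<chi> n" for n using per m_pos by (simp add: \<chi>_def coprime_mod_left_iff)
  qed
  moreover have "\<chi> g \<noteq> 1"
  proof
    assume "\<chi> g = 1"
    hence fg: "f g = f 1" using g f1 by (simp add: \<chi>_def split: if_splits)
    have "f (g ^ k) = f 1" for k using fpow[OF g(1), of k] fg f1 by simp
    hence "of_nat ?K * f 1 = 0" using orb[of 1] by simp
    thus False using f1 totient_m_pos by simp
  qed
  ultimately show ?thesis by blast
qed

text \<open>Orthogonality: multiplication by a character \<open>\<psi>\<close> with
  \<open>\<psi> n \<noteq> 1\<close> permutes the characters and multiplies the sum by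
  \<open>\<psi> n\<close>.\<close>

lemma sum_dirichlet_characters:
  "(\<Sum>\<chi>\<in>dirichlet_characters m. \<chi> n) = (if [n = 1] (mod m) then of_nat (card (dirichlet_characters m)) else 0)"
proof -
  consider "[n = 1] (mod m)" | "\<not> coprime n m" "\<not> [n = 1] (mod m)" | "coprime n m" "\<not> [n = 1] (mod m)" by blast
  thus ?thesis
  proof cases
    case 1
    have "\<chi> n = 1" if "\<chi> \<in> dirichlet_characters m" for \<chi>
      using dirichlet_character_cong[OF that 1] dirichlet_characterD(2)[OF that] by simp
    hence "(\<Sum>\<chi>\<in>dirichlet_characters m. \<chi> n) = (\<Sum>\<chi>\<in>dirichlet_characters m. 1)"
      by (intro sum.cong) auto
    thus ?thesis using 1 by simp
  next
    case 2
    have "\<chi> n = 0" if "\<chi> \<in> dirichlet_characters m" for \<chi>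
      using dirichlet_characterD(3)[OF that] 2 by blast
    hence "(\<Sum>\<chi>\<in>dirichlet_characters m. \<chi> n) = 0" by (intro sum.neutral) auto
    thus ?thesis using 2 by simp
  next
    case 3
    then obtain \<psi> where \<psi>: "\<psi> \<in> dirichlet_characters m" "\<psi> n \<noteq> 1" using exists_separating_character by blast
    have inv: "(\<lambda>n. cnj (\<psi> n) * (\<psi> n * \<chi> n)) = \<chi>" "(\<lambda>n. \<psi> n * (cnj (\<psi> n) * \<chi> n)) = \<chi>"
      if "\<chi> \<in> dirichlet_characters m" for \<chi>
    proof -
      have "cnj (\<psi> k) * (\<psi> k * \<chi> k) = \<chi> k" for k
      proof -
        have "cnj (\<psi> k) * (\<psi> k * \<chi> k) = (cnj (\<psi> k) * \<psi> k) * \<chi> k" by (rule mult.assoc[symmetric])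
        also have "\<dots> = \<chi> k"
          unfolding cnj_mult_dirichlet_character[OF \<psi>(1)] using dirichlet_characterD(3)[OF that, of k] by auto
        finally show ?thesis .
      qed
      thus "(\<lambda>n. cnj (\<psi> n) * (\<psi> n * \<chi> n)) = \<chi>" "(\<lambda>n. \<psi> n * (cnj (\<psi> n) * \<chi> n)) = \<chi>"
        by (auto simp: mult.left_commute)
    qed
    have "(\<Sum>\<chi>\<in>dirichlet_characters m. \<psi> n * \<chi> n) = (\<Sum>\<chi>\<in>dirichlet_characters m. \<chi> n)"
      by (rule sum.reindex_bij_witness[where i = "\<lambda>\<chi> n. cnj (\<psi> n) * \<chi> n" and j = "\<lambda>\<chi> n. \<psi> n * \<chi> n"])
         (simp_all add: inv dirichlet_characters_mult[OF \<psi>(1)] dirichlet_characters_mult[OF dirichlet_characters_cnj[OF \<psi>(1)]])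
    hence "\<psi> n * (\<Sum>\<chi>\<in>dirichlet_characters m. \<chi> n) = (\<Sum>\<chi>\<in>dirichlet_characters m. \<chi> n)"
      by (simp add: sum_distrib_left)
    thus ?thesis using \<psi>(2) 3 by (metis mult_cancel_right2)
  qed
qed

end

section \<open>Primes in arithmetic progressions\<close>

text \<open>With \<open>b\<close> an inverse of \<open>a\<close> modulo \<open>m\<close> this
  selects the progression of \<open>a\<close>; the factor \<open>\<chi> b\<close> takes the place of
  the usual conjugate of \<open>\<chi> a\<close>.\<close>

lemma sum_characters_twisted_mangoldt_sum:
  assumes "m > 0"
  shows "(\<Sum>\<chi>\<in>dirichlet_characters m. \<chi> b * twisted_mangoldt_sum \<chi> N) =
    of_real (real (card (dirichlet_characters m)) *
      (\<Sum>n | n \<in> {1..N} \<and> [b * n = 1] (mod m). mangoldt n / real n))"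
proof -
  let ?D = "dirichlet_characters m"
  have "(\<Sum>\<chi>\<in>?D. \<chi> b * twisted_mangoldt_sum \<chi> N) =
        (\<Sum>\<chi>\<in>?D. \<Sum>n=1..N. \<chi> (b * n) * of_real (mangoldt n / real n))"
    by (intro sum.cong refl)
       (simp add: twisted_mangoldt_sum_def sum_distrib_left dirichlet_characterD(1)[OF assms] mult.assoc)
  also have "\<dots> = (\<Sum>n=1..N. (\<Sum>\<chi>\<in>?D. \<chi> (b * n)) * of_real (mangoldt n / real n))"
    by (subst sum.swap) (simp only: sum_distrib_right)
  also have "\<dots> = (\<Sum>n=1..N. of_real (if [b * n = 1] (mod m) then real (card ?D) * (mangoldt n / real n) else 0))"
    unfolding sum_dirichlet_characters[OF assms] by (intro sum.cong refl) simp
  also have "\<dots> = of_real (\<Sum>n=1..N. if [b * n = 1] (mod m) then real (card ?D) * (mangoldt n / real n) else 0)"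
    by (rule of_real_sum[symmetric])
  also have "(\<Sum>n=1..N. if [b * n = 1] (mod m) then real (card ?D) * (mangoldt n / real n) else 0) =
     (\<Sum>n | n \<in> {1..N} \<and> [b * n = 1] (mod m). real (card ?D) * (mangoldt n / real n))"
    by (rule sum.inter_filter[symmetric]) simp
  finally show ?thesis by (simp only: sum_distrib_left)
qed

lemma Re_twisted_mangoldt_sum_le:
  assumes "m > 0" "\<chi> \<in> dirichlet_characters m" "N > 0"
  shows "Re (twisted_mangoldt_sum \<chi> N) \<le> ln (real N) + 4"
proof -
  have "norm (twisted_mangoldt_sum \<chi> N) \<le> (\<Sum>n=1..N. mangoldt n / real n)"
    unfolding twisted_mangoldt_sum_def
  proof (rule sum_norm_le)
    fix n
    have "norm (\<chi> n) * (mangoldt n / real n) \<le> 1 * (mangoldt n / real n)"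
      using norm_dirichlet_character[OF assms(1,2), of n] mangoldt_nonneg[of n] by (intro mult_right_mono) auto
    thus "norm (\<chi> n * of_real (mangoldt n / real n)) \<le> mangoldt n / real n"
      unfolding norm_mult norm_of_real using mangoldt_nonneg[of n] by simp
  qed
  also have "\<dots> \<le> ln (real N) + 4" by (rule mangoldt_div_sum_le) fact
  finally show ?thesis using complex_Re_le_cmod order_trans by blast
qed

text \<open>One-sided so that it holds before non-vanishing is known: for \<open>L = 0\<close> the
  sum behaves like \<open>-ln N\<close>. It controls the remaining characters in the proof of
  \<open>L_nonzero\<close>.\<close>

lemma Re_twisted_mangoldt_sum_bounded_above:
  assumes "bounded_character \<chi> M"
  shows "\<exists>C. \<forall>N>0. Re (twisted_mangoldt_sum \<chi> N) \<le> C"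
proof -
  interpret bounded_character \<chi> M by fact
  show ?thesis
  proof (cases "L = 0")
    case True
    have "Re (twisted_mangoldt_sum \<chi> N) \<le> 2 * M" if "N > 0" for N
    proof -
      have "Re (S N + of_real (ln (real N))) \<le> 2 * M"
        using S_asymptotics_if_L_eq_0[OF True that] complex_Re_le_cmod order_trans by blast
      moreover have "ln (real N) \<ge> 0" using that by simp
      ultimately show ?thesis by simp
    qed
    thus ?thesis by blast
  next
    case False
    then obtain C where "\<forall>N. norm (S N) \<le> C" using S_bounded by blast
    thus ?thesis using complex_Re_le_cmod order_trans by blast
  qed
qed

text \<open>
  The sum over all characters of the twisted sums is nonnegative, whereas a vanishing \<open>L(1)\<close>
  contributes \<open>-ln N\<close>; only the principal character contributes \<open>+ln N\<close>, so at most one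
  \<open>L(1)\<close> vanishes, and a non-real character would bring along its conjugate.
\<close>

lemma L_nonzero:
  assumes m: "m > 0" and \<chi>: "\<chi> \<in> dirichlet_characters m" "\<chi> \<noteq> principal_character m"
  shows "bounded_character.L \<chi> \<noteq> 0"
proof
  assume L0: "bounded_character.L \<chi> = 0"
  let ?D = "dirichlet_characters m" and ?\<chi>\<^sub>0 = "principal_character m"
  let ?W = twisted_mangoldt_sum and ?M = "real m + 1"
  define \<chi>' where "\<chi>' n = cnj (\<chi> n)" for n
  interpret bounded_character \<chi> ?M by (rule nonprincipal_bounded_character[OF m \<chi>])
  have \<chi>': "\<chi>' \<in> ?D" "\<chi>' \<noteq> ?\<chi>\<^sub>0"
  proof -
    show "\<chi>' \<in> ?D" unfolding \<chi>'_def by (rule dirichlet_characters_cnj[OF m \<chi>(1)])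
    show "\<chi>' \<noteq> ?\<chi>\<^sub>0"
    proof
      assume eq: "\<chi>' = ?\<chi>\<^sub>0"
      have "\<chi> n = ?\<chi>\<^sub>0 n" for n
      proof -
        have "cnj (\<chi> n) = ?\<chi>\<^sub>0 n" using fun_cong[OF eq, of n] by (simp add: \<chi>'_def)
        hence "\<chi> n = cnj (?\<chi>\<^sub>0 n)" by (metis complex_cnj_cnj)
        thus ?thesis by (simp add: principal_character_def)
      qed
      thus False using \<chi>(2) by blast
    qed
  qed
  interpret conj: bounded_character \<chi>' ?M by (rule nonprincipal_bounded_character[OF m \<chi>'])
  \<comment> \<open>A self-conjugate character is real with absolute values 0 or 1, hence covered by
    the Lambert series argument.\<close>
  have "\<chi>' \<noteq> \<chi>"
  proof
    assume eq: "\<chi>' = \<chi>"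
    have "\<chi> n \<in> {-1, 0, 1}" for n
    proof -
      have "\<chi> n \<in> \<real>" using fun_cong[OF eq, of n] by (simp add: \<chi>'_def Reals_cnj_iff)
      then obtain x where x: "\<chi> n = of_real x" by (auto elim: Reals_cases)
      have "\<bar>x\<bar> = 1 \<or> \<bar>x\<bar> = 0" using norm_dirichlet_character[OF m \<chi>(1), of n] x by (auto split: if_splits)
      thus ?thesis using x by (auto simp: abs_if split: if_splits)
    qed
    thus False using L_nonzero_if_real L0 by blast
  qed
  have conj_L0: "conj.L = 0"
  proof (rule LIMSEQ_unique[OF conj.G_tendsto])
    have "conj.G = (\<lambda>N. cnj (G N))" by (auto simp: conj.G_def G_def \<chi>'_def)
    moreover have "(\<lambda>N. cnj (G N)) \<longlonglongrightarrow> cnj L" by (intro tendsto_cnj G_tendsto)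
    ultimately show "conj.G \<longlonglongrightarrow> 0" using L0 by simp
  qed
  define R where "R = ?D - {?\<chi>\<^sub>0, \<chi>, \<chi>'}"
  have finD: "finite ?D" by (rule finite_dirichlet_characters[OF m])
  have "\<exists>C. \<forall>N>0. Re (?W \<psi> N) \<le> C" if "\<psi> \<in> R" for \<psi>
    by (rule Re_twisted_mangoldt_sum_bounded_above[OF nonprincipal_bounded_character[OF m]])
       (use that in \<open>auto simp: R_def\<close>)
  then obtain C where C: "\<And>\<psi> N. \<psi> \<in> R \<Longrightarrow> N > 0 \<Longrightarrow> Re (?W \<psi> N) \<le> C \<psi>"
    by metis
  \<comment> \<open>The principal character contributes at most \<open>ln N + 4\<close>, and
    \<open>\<chi>\<close> and \<open>\<chi>'\<close> at most \<open>2 * ?M - ln N\<close> each. So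
    one \<open>-ln N\<close> remains in a sum that is nonnegative.\<close>
  have bound: "ln (real N) \<le> 4 + 4 * ?M + (\<Sum>\<psi>\<in>R. C \<psi>)" if N: "N > 0" for N
  proof -
    have "0 \<le> real (card ?D) * (\<Sum>n | n \<in> {1..N} \<and> [1 * n = 1] (mod m). mangoldt n / real n)"
      by (intro mult_nonneg_nonneg sum_nonneg) (auto intro!: divide_nonneg_nonneg mangoldt_nonneg)
    also have "\<dots> = Re (\<Sum>\<psi>\<in>?D. \<psi> 1 * ?W \<psi> N)"
      unfolding sum_characters_twisted_mangoldt_sum[OF m] by simp
    also have "\<dots> = (\<Sum>\<psi>\<in>?D. Re (?W \<psi> N))"
      unfolding Re_sum by (intro sum.cong refl) (simp only: dirichlet_characterD(2)[OF m] mult_1)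
    also have "?D = {?\<chi>\<^sub>0, \<chi>, \<chi>'} \<union> R"
      using \<chi> \<chi>' principal_character_in[OF m] by (auto simp: R_def)
    also have "(\<Sum>\<psi>\<in>{?\<chi>\<^sub>0, \<chi>, \<chi>'} \<union> R. Re (?W \<psi> N)) =
       (\<Sum>\<psi>\<in>{?\<chi>\<^sub>0, \<chi>, \<chi>'}. Re (?W \<psi> N)) + (\<Sum>\<psi>\<in>R. Re (?W \<psi> N))"
      by (rule sum.union_disjoint) (use finD in \<open>auto simp: R_def\<close>)
    also have "(\<Sum>\<psi>\<in>{?\<chi>\<^sub>0, \<chi>, \<chi>'}. Re (?W \<psi> N)) = Re (?W ?\<chi>\<^sub>0 N) + Re (?W \<chi> N) + Re (?W \<chi>' N)"
      using \<chi>(2) \<chi>'(2) \<open>\<chi>' \<noteq> \<chi>\<close> by simp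
    finally have "0 \<le> Re (?W ?\<chi>\<^sub>0 N) + Re (?W \<chi> N) + Re (?W \<chi>' N) + (\<Sum>\<psi>\<in>R. Re (?W \<psi> N))" .
    moreover have "Re (?W ?\<chi>\<^sub>0 N) \<le> ln (real N) + 4"
      by (rule Re_twisted_mangoldt_sum_le[OF m principal_character_in[OF m] N])
    moreover have "Re (?W \<chi> N + of_real (ln (real N))) \<le> 2 * ?M"
      using S_asymptotics_if_L_eq_0[OF L0 N] complex_Re_le_cmod order_trans by blast
    moreover have "Re (?W \<chi>' N + of_real (ln (real N))) \<le> 2 * ?M"
      using conj.S_asymptotics_if_L_eq_0[OF conj_L0 N] complex_Re_le_cmod order_trans by blast
    moreover have "(\<Sum>\<psi>\<in>R. Re (?W \<psi> N)) \<le> (\<Sum>\<psi>\<in>R. C \<psi>)" using C N by (intro sum_mono) auto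
    ultimately show ?thesis by simp
  qed
  define K where "K = 4 + 4 * ?M + (\<Sum>\<psi>\<in>R. C \<psi>)"
  obtain N where N: "exp K < real N" using reals_Archimedean2 by blast
  hence "N > 0" using exp_gt_zero[of K] by (intro Nat.gr0I) auto
  hence "ln (exp K) < ln (real N)" using N by (subst ln_less_cancel_iff) auto
  thus False using bound[OF \<open>N > 0\<close>] by (simp add: K_def)
qed

section \<open>Divergence for the principal character\<close>

lemma harmonic_sum_ge_ln: "ln (real (Suc J)) \<le> (\<Sum>j=1..J. 1 / real j)"
proof (induction J)
  case (Suc J)
  have "real (Suc J) * (ln (real (Suc (Suc J))) - ln (real (Suc J))) \<le> 1"
    by (rule ln_Suc_diff_le) simp
  hence "ln (real (Suc (Suc J))) - ln (real (Suc J)) \<le> 1 / real (Suc J)"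
    by (simp add: pos_le_divide_eq mult.commute del: of_nat_Suc)
  thus ?case using Suc by simp
qed simp

text \<open>The numbers \<open>j * m + 1\<close> alone suffice: they are coprime to \<open>m\<close>
  and at most \<open>j * (m + 1)\<close>.\<close>

lemma coprime_harmonic_sum_unbounded:
  fixes C :: real
  assumes m: "m > 0"
  shows "\<exists>N. C < (\<Sum>n=1..N. (if coprime n m then 1 else 0) / real n)"
proof -
  obtain J :: nat where J: "exp (C * (real m + 1)) < real J" using reals_Archimedean2 by blast
  have "C * (real m + 1) < ln (real (Suc J))"
  proof -
    have "C * (real m + 1) = ln (exp (C * (real m + 1)))" by simp
    also have "\<dots> < ln (real (Suc J))" using J by (subst ln_less_cancel_iff) auto
    finally show ?thesis .
  qed
  also have "\<dots> \<le> (\<Sum>j=1..J. 1 / real j)" by (rule harmonic_sum_ge_ln)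
  finally have "C < (\<Sum>j=1..J. 1 / real j) / (real m + 1)" using m by (simp add: pos_less_divide_eq)
  also have "\<dots> = (\<Sum>j=1..J. 1 / (real j * (real m + 1)))" by (simp add: sum_divide_distrib)
  also have "\<dots> \<le> (\<Sum>j=1..J. 1 / real (j * m + 1))"
  proof (rule sum_mono)
    fix j assume j: "j \<in> {1..J}"
    have "real (j * m + 1) \<le> real j * (real m + 1)" using j by (simp add: algebra_simps)
    thus "1 / (real j * (real m + 1)) \<le> 1 / real (j * m + 1)" by (intro divide_left_mono mult_pos_pos) (use j in \<open>auto simp: add_pos_nonneg\<close>)
  qed
  also have "\<dots> = (\<Sum>j=1..J. (if coprime (j * m + 1) m then 1 else 0) / real (j * m + 1))"
  proof (rule sum.cong[OF refl])
    fix j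
    have "coprime (j * m + 1) m"
    proof (rule coprimeI)
      fix c assume "c dvd j * m + 1" "c dvd m"
      thus "is_unit c" by (metis dvd_add_right_iff dvd_mult)
    qed
    thus "1 / real (j * m + 1) = (if coprime (j * m + 1) m then 1 else 0) / real (j * m + 1)" by simp
  qed
  also have "\<dots> = (\<Sum>n\<in>(\<lambda>j. j * m + 1) ` {1..J}. (if coprime n m then 1 else 0) / real n)"
    by (subst sum.reindex) (use m in \<open>auto simp: inj_on_def\<close>)
  also have "\<dots> \<le> (\<Sum>n=1..J*m+1. (if coprime n m then 1 else 0) / real n)"
    by (intro sum_mono2) auto
  finally show ?thesis by blast
qed

text \<open>If \<open>S\<close> were bounded by \<open>C'\<close>, splitting \<open>ln n\<close>
  over divisors would bound the sum of \<open>w n * ln n / n\<close> by \<open>C' * H N\<close>.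
  Since \<open>ln n\<close> eventually exceeds \<open>C' + 1\<close>, this would bound
  \<open>H N\<close>, the harmonic sum over integers coprime to \<open>m\<close>.\<close>

lemma principal_twisted_mangoldt_sum_unbounded:
  assumes m: "m > 0"
  shows "\<exists>N>0. C < Re (twisted_mangoldt_sum (principal_character m) N)"
proof (rule ccontr)
  assume contra: "\<not> ?thesis"
  define w :: "nat \<Rightarrow> real" where "w n = (if coprime n m then 1 else 0)" for n
  define C' where "C' = max C 0"
  define S where "S N = (\<Sum>n=1..N. w n * (mangoldt n / real n))" for N
  define H where "H N = (\<Sum>n=1..N. w n / real n)" for N
  have w: "w n \<ge> 0" "w n \<le> 1" for n by (auto simp: w_def)
  have w_mult: "w (a * b) = w a * w b" for a b by (simp add: w_def coprime_mult_left_iff)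
  have "Re (twisted_mangoldt_sum (principal_character m) N) = S N" for N
    unfolding twisted_mangoldt_sum_def S_def Re_sum
    by (intro sum.cong refl) (simp add: w_def principal_character_def del: of_real_mangoldt)
  hence "S N \<le> C" if "N > 0" for N using contra that by (metis not_less)
  hence S_le: "S N \<le> C'" for N by (cases "N = 0") (auto simp: C'_def S_def max.coboundedI1)
  have H_mono: "H a \<le> H b" if "a \<le> b" for a b
    unfolding H_def using that w by (intro sum_mono2) auto
  have H_nonneg: "H N \<ge> 0" for N unfolding H_def using w by (intro sum_nonneg) auto
  have le: "(\<Sum>n=1..N. w n * ln (real n) / real n) \<le> C' * H N" for N
  proof -
    have "(\<Sum>n=1..N. w n * ln (real n) / real n) =
        (\<Sum>n=1..N. \<Sum>d | d dvd n. (w d * (mangoldt d / real d)) * (w (n div d) / real (n div d)))"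
    proof (rule sum.cong[OF refl])
      fix n assume n: "n \<in> {1..N}"
      have "w n * ln (real n) / real n = (\<Sum>d | d dvd n. w n / real n * mangoldt d)"
        using mangoldt_sum[of n, where ?'a = real] n unfolding sum_distrib_left[symmetric] by simp
      also have "\<dots> = (\<Sum>d | d dvd n. (w d * (mangoldt d / real d)) * (w (n div d) / real (n div d)))"
      proof (rule sum.cong[OF refl])
        fix d assume "d \<in> {d. d dvd n}"
        then obtain k where k: "n = d * k" by auto
        with n have "d > 0" "k > 0" by auto
        thus "w n / real n * mangoldt d = (w d * (mangoldt d / real d)) * (w (n div d) / real (n div d))"
          unfolding k by (simp add: w_mult)
      qed
      finally show "w n * ln (real n) / real n =
        (\<Sum>d | d dvd n. (w d * (mangoldt d / real d)) * (w (n div d) / real (n div d)))" .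
    qed
    also have "\<dots> = (\<Sum>d=1..N. \<Sum>k=1..N div d. (w d * (mangoldt d / real d)) * (w k / real k))"
      by (rule sum_divisors_swap)
    also have "\<dots> = (\<Sum>d=1..N. (w d * (mangoldt d / real d)) * H (N div d))"
      by (simp only: H_def sum_distrib_left)
    also have "\<dots> \<le> (\<Sum>d=1..N. (w d * (mangoldt d / real d)) * H N)"
      using w mangoldt_nonneg by (intro sum_mono mult_left_mono H_mono) auto
    also have "\<dots> = S N * H N" by (simp add: S_def sum_distrib_right)
    also have "\<dots> \<le> C' * H N" by (intro mult_right_mono S_le H_nonneg)
    finally show ?thesis .
  qed
  \<comment> \<open>From \<open>n1\<close> on \<open>ln n\<close> exceeds \<open>C' + 1\<close>;
    each of the fewer than \<open>n1\<close> earlier terms loses at most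
    \<open>C' + 1\<close>.\<close>
  obtain n1 :: nat where n1: "exp (C' + 1) < real n1" using reals_Archimedean2 by blast
  have "H N \<le> real n1 * (C' + 1)" for N
  proof -
    have "- (real n1 * (C' + 1)) = (\<Sum>n<n1. - (C' + 1))"
      by (simp only: sum_constant card_lessThan mult_minus_right)
    also have "\<dots> \<le> (\<Sum>n\<in>{1..N} \<inter> {..<n1}. - (C' + 1))"
      unfolding sum_negf neg_le_iff_le by (intro sum_mono2) (auto simp: C'_def)
    also have "\<dots> = (\<Sum>n=1..N. if n < n1 then - (C' + 1) else 0)"
      by (subst sum.inter_restrict) auto
    also have "\<dots> \<le> (\<Sum>n=1..N. w n * ln (real n) / real n - (C' + 1) * (w n / real n))"
    proof (rule sum_mono)
      fix n assume n: "n \<in> {1..N}"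
      show "(if n < n1 then - (C' + 1) else 0) \<le> w n * ln (real n) / real n - (C' + 1) * (w n / real n)"
      proof (cases "n < n1")
        case True
        have "w n / real n \<le> 1 / 1" using w n by (intro frac_le) auto
        hence "(C' + 1) * (w n / real n) \<le> (C' + 1) * 1" by (intro mult_left_mono) (auto simp: C'_def)
        moreover have "w n * ln (real n) / real n \<ge> 0" using w n by auto
        ultimately show ?thesis using True by simp
      next
        case False
        have "C' + 1 = ln (exp (C' + 1))" by simp
        also have "\<dots> \<le> ln (real n)" using False n1 n by (subst ln_le_cancel_iff) auto
        finally have "(C' + 1) * (w n / real n) \<le> ln (real n) * (w n / real n)"
          using w by (intro mult_right_mono) auto
        thus ?thesis using False by (simp add: mult.commute)
      qed
    qed
    also have "\<dots> = (\<Sum>n=1..N. w n * ln (real n) / real n) - (C' + 1) * H N"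
      by (simp only: sum_subtractf H_def sum_distrib_left)
    also have "\<dots> \<le> - H N" using le[of N] by (simp add: algebra_simps)
    finally show ?thesis by simp
  qed
  thus False using coprime_harmonic_sum_unbounded[OF m, of "real n1 * (C' + 1)"]
    unfolding H_def w_def by (meson not_less)
qed

text \<open>An antiderivative of \<open>ln x / x\<^sup>2\<close> is \<open>-(ln x + 1) / x\<close>.
  In the discrete version the constant has to be at least
  \<open>(n + 1) (ln (n + 1) - ln n)\<close>, which is above 1 but at most 2.\<close>

lemma ln_div_telescope:
  assumes "n > 0"
  shows "ln (real (Suc n)) / (real (Suc n) * real n) \<le> (ln (real n) + 2) / real n - (ln (real (Suc n)) + 2) / real (Suc n)"
proof -
  have n: "real n \<ge> 1" using assms by simp
  define a b where "a = ln (real n)" and "b = ln (real (Suc n))"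
  have 1: "real n * (b - a) \<le> 1" unfolding a_def b_def by (rule ln_Suc_diff_le) fact
  have "b \<ge> a" by (simp add: a_def b_def assms)
  hence "1 * (b - a) \<le> real n * (b - a)" using n by (intro mult_right_mono) auto
  hence "b \<le> (real n + 1) * (a + 2) - real n * (b + 2)" using 1 by (simp add: algebra_simps)
  hence "b / ((real n + 1) * real n) \<le> ((real n + 1) * (a + 2) - real n * (b + 2)) / ((real n + 1) * real n)"
    using n by (intro divide_right_mono) auto
  also have "\<dots> = (a + 2) / real n - (b + 2) / (real n + 1)" using n by (simp add: field_simps)
  finally show ?thesis by (simp add: a_def b_def add.commute)
qed

text \<open>Only powers \<open>p ^ k\<close> with \<open>k \<ge> 2\<close> contribute, and for each
  \<open>p\<close> their geometric series gives at most \<open>ln p / (p (p - 1))\<close>. Summed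
  over all integers instead of primes, this telescopes from the value
  \<open>ln 1 + 2 = 2\<close>.\<close>

lemma mangoldt_nonprime_sum_le:
  "(\<Sum>n | n \<in> {1..N} \<and> \<not> prime n. mangoldt n / real n) \<le> 2"
proof -
  define I where "I = {p \<in> {2..N}. prime p} \<times> {2..N}"
  have "(\<Sum>n | n \<in> {1..N} \<and> \<not> prime n. mangoldt n / real n) \<le> (\<Sum>n\<in>(\<lambda>(p, k). p ^ k) ` I. mangoldt n / real n)"
  proof -
    have "(\<Sum>n | n \<in> {1..N} \<and> \<not> prime n. mangoldt n / real n) =
          (\<Sum>n | n \<in> {1..N} \<and> primepow n \<and> \<not> prime n. mangoldt n / real n)"
      by (rule sum.mono_neutral_right) (auto simp: mangoldt_def)
    also have "\<dots> \<le> (\<Sum>n\<in>(\<lambda>(p, k). p ^ k) ` I. mangoldt n / real n)"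
    proof (rule sum_mono2)
      show "{n. n \<in> {1..N} \<and> primepow n \<and> \<not> prime n} \<subseteq> (\<lambda>(p, k). p ^ k) ` I"
      proof
        fix n assume "n \<in> {n. n \<in> {1..N} \<and> primepow n \<and> \<not> prime n}"
        then obtain p k where pk: "prime p" "k > 0" "n = p ^ k" "n \<le> N" "\<not> prime n"
          by (auto simp: primepow_def)
        have p2: "p \<ge> 2" using pk(1) by (rule prime_ge_2_nat)
        have "k \<noteq> 1" using pk by auto
        hence "k \<ge> 2" using pk by simp
        moreover have "k < 2 ^ k" by (rule less_exp)
        hence "k \<le> N" using power_mono[OF p2, of k] pk by linarith
        moreover have "p ^ 1 \<le> p ^ k" using p2 pk by (intro power_increasing) auto
        hence "p \<le> N" using pk by simp
        ultimately have "(p, k) \<in> I" using pk p2 by (auto simp: I_def)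
        thus "n \<in> (\<lambda>(p, k). p ^ k) ` I" using pk by force
      qed
    qed (auto simp: I_def intro!: divide_nonneg_nonneg mangoldt_nonneg)
    finally show ?thesis .
  qed
  also have "\<dots> \<le> (\<Sum>x\<in>I. ((\<lambda>n. mangoldt n / real n) \<circ> (\<lambda>(p, k). p ^ k)) x)"
    by (rule sum_image_le) (auto simp: I_def intro!: divide_nonneg_nonneg mangoldt_nonneg)
  also have "\<dots> = (\<Sum>(p, k)\<in>I. ln (real p) * (1 / real p ^ k))"
    by (intro sum.cong refl) (auto simp: I_def)
  also have "\<dots> = (\<Sum>p | p \<in> {2..N} \<and> prime p. \<Sum>k=2..N. ln (real p) * (1 / real p ^ k))"
    unfolding I_def by (rule sum.cartesian_product[symmetric])
  also have "\<dots> \<le> (\<Sum>p | p \<in> {2..N} \<and> prime p. ln (real p) / (real p * real (p - 1)))"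
  proof (rule sum_mono)
    fix p assume "p \<in> {p \<in> {2..N}. prime p}"
    hence p: "2 \<le> p" "p \<le> N" by auto
    define x where "x = real p"
    have x: "x \<ge> 2" "real (p - 1) = x - 1" using p by (auto simp: x_def of_nat_diff)
    have geo: "(x - 1) * (\<Sum>k=2..Suc j. 1 / x ^ k) = 1 / x - 1 / x ^ Suc j" for j
    proof (induction j)
      case (Suc j)
      show ?case
      proof (cases "j = 0")
        case True
        then show ?thesis using x by (simp add: field_simps power2_eq_square numeral_2_eq_2)
      next
        case False
        have "(x - 1) * (\<Sum>k=2..Suc (Suc j). 1 / x ^ k) = (x - 1) * (\<Sum>k=2..Suc j. 1 / x ^ k) + (x - 1) * (1 / x ^ Suc (Suc j))"
          by (simp add: distrib_left)
        also have "(x - 1) * (1 / x ^ Suc (Suc j)) = 1 / x ^ Suc j - 1 / x ^ Suc (Suc j)"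
          using x by (simp add: field_simps)
        finally show ?thesis unfolding Suc by simp
      qed
    qed (use x in simp)
    have "(x - 1) * (\<Sum>k=2..N. 1 / x ^ k) = 1 / x - 1 / x ^ N" using geo[of "N - 1"] p by simp
    also have "\<dots> \<le> 1 / x" using x by simp
    finally have "(\<Sum>k=2..N. 1 / x ^ k) \<le> 1 / (x * (x - 1))" using x by (simp add: pos_le_divide_eq mult_ac)
    hence "ln x * (\<Sum>k=2..N. 1 / x ^ k) \<le> ln x * (1 / (x * (x - 1)))"
      using x by (intro mult_left_mono) auto
    thus "(\<Sum>k=2..N. ln (real p) * (1 / real p ^ k)) \<le> ln (real p) / (real p * real (p - 1))"
      unfolding x(2) by (simp add: x_def[symmetric] sum_distrib_left)
  qed
  also have "\<dots> \<le> (\<Sum>p\<in>Suc ` {1..N}. ln (real p) / (real p * real (p - 1)))"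
  proof (rule sum_mono2)
    show "{p \<in> {2..N}. prime p} \<subseteq> Suc ` {1..N}" by (auto simp: image_Suc_atLeastAtMost)
  qed auto
  also have "\<dots> = (\<Sum>n=1..N. ln (real (Suc n)) / (real (Suc n) * real n))"
    by (subst sum.reindex) auto
  also have "\<dots> \<le> (\<Sum>n=1..N. (ln (real n) + 2) / real n - (ln (real (Suc n)) + 2) / real (Suc n))"
    by (intro sum_mono ln_div_telescope) auto
  also have "\<dots> = 2 - (ln (real (Suc N)) + 2) / real (Suc N)"
    by (induction N) auto
  also have "\<dots> \<le> 2" by (simp add: ln_ge_zero add_nonneg_nonneg)
  finally show ?thesis .
qed

text \<open>With finitely many primes in the progression its sum of \<open>mangoldt n / n\<close>
  stays below \<open>K + 2\<close>, the 2 covering proper prime powers. Orthogonality then bounds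
  the sum of the principal character, since all other characters contribute
  \<open>O(1)\<close>.\<close>

theorem dirichlet_primes_in_progression:
  assumes m: "m > 0" and a: "coprime a m"
  shows "infinite {p::nat. prime p \<and> [p = a] (mod m)}"
proof
  assume fin: "finite {p. prime p \<and> [p = a] (mod m)}" (is "finite ?P")
  let ?D = "dirichlet_characters m" and ?\<chi>\<^sub>0 = "principal_character m"
  let ?W = twisted_mangoldt_sum
  obtain b where b: "[a * b = 1] (mod m)" using cong_solve_coprime_nat[OF a] by auto
  have b_cop: "coprime b m" 
    using cong_imp_coprime[OF cong_sym[OF b]] by (simp add: coprime_mult_left_iff)
  have b_iff: "[b * n = 1] (mod m) \<Longrightarrow> [n = a] (mod m)" for n
  proof -
    assume "[b * n = 1] (mod m)"
    hence "[a * (b * n) = a * 1] (mod m)" by (rule cong_scalar_left)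
    hence 1: "[a * b * n = a] (mod m)" by (simp add: mult.assoc)
    have "[a * b * n = 1 * n] (mod m)" using b by (rule cong_scalar_right)
    hence "[n = a * b * n] (mod m)" by (simp add: cong_sym)
    thus ?thesis using 1 by (rule cong_trans)
  qed
  have finD: "finite ?D" by (rule finite_dirichlet_characters[OF m])
  have "\<exists>C. \<forall>N. norm (?W \<psi> N) \<le> C" if "\<psi> \<in> ?D - {?\<chi>\<^sub>0}" for \<psi>
    by (rule bounded_character.S_bounded[OF nonprincipal_bounded_character[OF m] L_nonzero[OF m]])
       (use that in auto)
  then obtain C where C: "\<And>\<psi> N. \<psi> \<in> ?D - {?\<chi>\<^sub>0} \<Longrightarrow> norm (?W \<psi> N) \<le> C \<psi>" by metis
  define K where "K = (\<Sum>n\<in>?P. mangoldt n / real n)"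
  have "Re (?W ?\<chi>\<^sub>0 N) \<le> real (card ?D) * (K + 2) + (\<Sum>\<psi>\<in>?D - {?\<chi>\<^sub>0}. C \<psi>)" for N
  proof -
    let ?A = "{n. n \<in> {1..N} \<and> [b * n = 1] (mod m)}" and ?f = "\<lambda>n. mangoldt n / real n :: real"
    have f0: "?f n \<ge> 0" for n using mangoldt_nonneg by (intro divide_nonneg_nonneg) auto
    have "Re (?W ?\<chi>\<^sub>0 N) = Re (\<Sum>\<psi>\<in>?D. \<psi> b * ?W \<psi> N) - (\<Sum>\<psi>\<in>?D - {?\<chi>\<^sub>0}. Re (\<psi> b * ?W \<psi> N))"
      using finD principal_character_in[OF m] b_cop
      by (subst sum.remove[of _ ?\<chi>\<^sub>0]) (auto simp: principal_character_def)
    moreover have "- (\<Sum>\<psi>\<in>?D - {?\<chi>\<^sub>0}. Re (\<psi> b * ?W \<psi> N)) \<le> (\<Sum>\<psi>\<in>?D - {?\<chi>\<^sub>0}. C \<psi>)"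
      unfolding sum_negf[symmetric]
    proof (rule sum_mono)
      fix \<psi> assume \<psi>: "\<psi> \<in> ?D - {?\<chi>\<^sub>0}"
      have "- Re (\<psi> b * ?W \<psi> N) \<le> norm (\<psi> b * ?W \<psi> N)" using abs_Re_le_cmod[of "\<psi> b * ?W \<psi> N"] by linarith
      also have "\<dots> = norm (?W \<psi> N)"
        using norm_dirichlet_character[OF m, of \<psi> b] \<psi> b_cop by (simp add: norm_mult)
      finally show "- Re (\<psi> b * ?W \<psi> N) \<le> C \<psi>" using C[OF \<psi>, of N] by linarith
    qed
    moreover have "Re (\<Sum>\<psi>\<in>?D. \<psi> b * ?W \<psi> N) = real (card ?D) * (\<Sum>n\<in>?A. ?f n)"
      unfolding sum_characters_twisted_mangoldt_sum[OF m] by simp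
    moreover have "(\<Sum>n\<in>?A. ?f n) \<le> K + 2"
    proof -
      have "(\<Sum>n\<in>?A. ?f n) \<le> (\<Sum>n\<in>?P \<union> {n. n \<in> {1..N} \<and> \<not> prime n}. ?f n)"
        by (rule sum_mono2) (use fin b_iff f0 in auto)
      also have "\<dots> = K + (\<Sum>n | n \<in> {1..N} \<and> \<not> prime n. ?f n)"
        unfolding K_def by (rule sum.union_disjoint) (use fin in auto)
      finally show ?thesis using mangoldt_nonprime_sum_le[of N] by linarith
    qed
    hence "real (card ?D) * (\<Sum>n\<in>?A. ?f n) \<le> real (card ?D) * (K + 2)" by (intro mult_left_mono) auto
    ultimately show ?thesis by linarith
  qed
  thus False
    using principal_twisted_mangoldt_sum_unbounded[OF m, of "real (card ?D) * (K + 2) + (\<Sum>\<psi>\<in>?D - {?\<chi>\<^sub>0}. C \<psi>)"]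
    by (meson not_less)
qed

section \<open>The decomposition theorem\<close>

lemma smooth_numbers_iff_composite:
  assumes "\<And>n. n \<ge> 1 \<Longrightarrow> real n / 2 < y n \<and> y n < real n"
  shows "n \<in> smooth_numbers y \<longleftrightarrow> n > 1 \<and> \<not> prime n"
proof -
  consider "n = 0" | "n = 1" | "n > 1" "prime n" | "n > 1" "\<not> prime n" by linarith
  thus ?thesis
  proof cases
    case 2
    \<comment> \<open>The conventional value 1 at \<open>n = 1\<close> exceeds \<open>y 1\<close>,
      so 1 is not smooth.\<close>
    thus ?thesis using assms[of 1] by (simp add: smooth_numbers_def greatest_prime_factor_def)
  next
    case 3
    hence "greatest_prime_factor n = n"
      by (simp add: greatest_prime_factor_def prime_prime_factors)
    thus ?thesis using assms[of n] 3 by (simp add: smooth_numbers_def)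
  next
    case 4
    define p where "p = Max (prime_factors n)"
    have "prime_factors n \<noteq> {}" using 4 by (simp add: prime_factorization_empty_iff)
    hence "p \<in> prime_factors n" unfolding p_def by (intro Max_in) auto
    hence p: "prime p" "p dvd n" by auto
    then obtain k where k: "n = p * k" by auto
    \<comment> \<open>A composite number has cofactor at least 2 to its largest prime factor, which
      is therefore at most \<open>n / 2\<close>.\<close>
    have "k \<noteq> 0" "k \<noteq> 1" using 4 k p by auto
    hence "p * 2 \<le> p * k" by (intro mult_left_mono) auto
    hence "real (p * 2) \<le> real n" unfolding k by (rule of_nat_mono)
    hence "real p \<le> real n / 2" by simp
    moreover have "greatest_prime_factor n = p" using 4 by (simp add: greatest_prime_factor_def p_def)
    ultimately show ?thesis using assms[of n] 4 by (simp add: smooth_numbers_def)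
  qed (simp add: smooth_numbers_def)
qed

lemma not_coprime_prime_divisor:
  fixes a b :: nat
  assumes "\<not> coprime a b"
  obtains l where "prime l" "l dvd a" "l dvd b"
proof -
  have "gcd a b \<noteq> 1" using assms unfolding coprime_iff_gcd_eq_1 .
  then obtain l where "prime l" "l dvd gcd a b" using prime_factor_nat by blast
  thus ?thesis using that by simp
qed

text \<open>The class of \<open>n\<close> is prescribed prime by prime: 1 modulo the primes of
  \<open>b\<close>, \<open>b n = 2\<close> modulo the other primes of \<open>P\<close>, and 1 modulo
  an auxiliary prime \<open>q\<close>, which makes \<open>n - 1\<close> a proper multiple of
  \<open>q\<close>. Then \<open>b n - 1\<close> is a unit at every prime of the modulus, so
  Dirichlet's theorem applies to it.\<close>

lemma exists_prime_multiple_minus_one: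
  fixes b P K :: nat
  assumes b: "b > 1" and P: "P > 0" and even: "even P \<Longrightarrow> even b"
  shows "\<exists>n\<ge>K. coprime n P \<and> n - 1 > 1 \<and> \<not> prime (n - 1) \<and> prime (b * n - 1)"
proof -
  define P' where "P' = \<Prod>{l \<in> prime_factors P. \<not> l dvd b}"
  \<comment> \<open>The size of \<open>q\<close> keeps it away from \<open>b\<close> and
    \<open>P\<close>, and also from \<open>b - 1\<close>, to which \<open>b n - 1\<close> is
    congruent modulo \<open>q\<close>.\<close>
  obtain q where q: "prime q" "q > b + P" using bigger_prime by blast
  have dvd_P': "l dvd P' \<Longrightarrow> prime l \<Longrightarrow> l dvd P \<and> \<not> l dvd b" for l
  proof -
    assume l: "l dvd P'" "prime l"
    then obtain l' where "l' \<in> prime_factors P" "\<not> l' dvd b" "l dvd l'"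
      unfolding P'_def using prime_dvd_prod_iff[of _ l "\<lambda>x. x"] by auto
    moreover from this have "l = l'" using l by (auto intro: primes_dvd_imp_eq)
    ultimately show ?thesis by auto
  qed
  have P'_pos: "P' > 0" unfolding P'_def by (intro prod_pos) (auto dest!: in_prime_factors_imp_prime intro: prime_gt_0_nat)
  have not_q: "\<not> q dvd b" "\<not> q dvd P" using q b P by (auto dest: dvd_imp_le)
  have cop_b: "coprime b P'"
  proof (rule ccontr)
    assume "\<not> coprime b P'"
    then obtain l where "prime l" "l dvd b" "l dvd P'" by (rule not_coprime_prime_divisor)
    thus False using dvd_P' by blast
  qed
  have cop_q: "coprime q P'" using dvd_P'[of q] q not_q by (auto intro: prime_imp_coprime)
  have cop: "coprime (b * q) P'" using cop_b cop_q by simp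
  obtain u where u: "[b * u = 1] (mod P')" using cong_solve_coprime_nat[OF cop_b] by auto
  obtain x where x: "[x = 1] (mod b * q)" "[x = 2 * u] (mod P')"
    using binary_chinese_remainder_nat[OF cop] by blast
  have bx: "[b * x = 2] (mod P')"
  proof -
    have "[b * x = b * (2 * u)] (mod P')" by (rule cong_scalar_left) (rule x)
    moreover have "[2 * (b * u) = 2 * 1] (mod P')" by (rule cong_scalar_left) (rule u)
    hence "[b * (2 * u) = 2] (mod P')" by (simp add: mult_ac)
    ultimately show ?thesis by (rule cong_trans)
  qed
  have x_pos: "x > 0"
  proof (rule Nat.gr0I)
    assume "x = 0"
    hence "[1 = 0] (mod b * q)" using cong_sym[OF x(1)] by simp
    hence "b * q dvd 1" unfolding cong_0_iff .
    thus False using b by simp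
  qed
  define m where "m = b * q * P'"
  have m_pos: "m > 0" using b q P'_pos by (simp add: m_def prime_gt_0_nat)
  have bx_pos: "b * x \<ge> 1" using b x_pos by (simp add: Suc_le_eq)
  \<comment> \<open>The modulus is \<open>b * m\<close> rather than \<open>m\<close>, so that
    \<open>p + 1\<close> is divisible by \<open>b\<close> and its quotient \<open>n\<close> is still
    determined modulo \<open>m\<close>.\<close>
  have "coprime (b * x - 1) (b * m)"
  proof (rule ccontr)
    assume "\<not> coprime (b * x - 1) (b * m)"
    then obtain l where l: "prime l" "l dvd b * x - 1" "l dvd b * m"
      by (rule not_coprime_prime_divisor)
    have bx1: "[b * x = 1] (mod l)"
      using l(2) bx_pos by (simp add: cong_altdef_nat)
    consider "l dvd b" | "l = q" | "l dvd P'"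
      using l q unfolding m_def by (auto simp: prime_dvd_mult_iff primes_dvd_imp_eq)
    thus False
    proof cases
      case 1
      hence "[b * x = 0] (mod l)" by (simp add: cong_0_iff)
      hence "[1 = 0] (mod l)" using bx1 cong_sym cong_trans by blast
      thus False using l by (simp add: cong_0_iff)
    next
      case 2
      have "[x = 1] (mod l)" using cong_dvd_modulus_nat[OF x(1), of l] 2 by simp
      hence "[b * x = b * 1] (mod l)" by (rule cong_scalar_left)
      hence "[b = 1] (mod q)" using bx1 cong_sym cong_trans 2 by (metis mult.right_neutral)
      thus False using b q by (simp add: cong_def)
    next
      case 3
      have "[b * x = 2] (mod l)" using cong_dvd_modulus_nat[OF bx 3] .
      hence "[2 = 1] (mod l)" using bx1 cong_sym cong_trans by blast
      hence "l dvd 2 - 1" by (subst (asm) cong_altdef_nat) auto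
      thus False using l by simp
    qed
  qed
  hence "infinite {p::nat. prime p \<and> [p = b * x - 1] (mod (b * m))}"
    using b m_pos by (intro dirichlet_primes_in_progression) auto
  \<comment> \<open>The lower bound makes \<open>n\<close> at least \<open>K\<close> and
    \<open>n - 1\<close> larger than \<open>q\<close>, so that \<open>q\<close> is a proper
    divisor.\<close>
  then obtain p where p: "prime p" "[p = b * x - 1] (mod (b * m))" "p > b * (K + q + 2)"
    unfolding infinite_nat_iff_unbounded by auto
  have "[p + 1 = b * x - 1 + 1] (mod (b * m))" by (rule cong_add[OF p(2) cong_refl])
  hence p1: "[p + 1 = b * x] (mod (b * m))" using bx_pos by simp
  have "b dvd p + 1" using cong_dvd_iff[OF cong_dvd_modulus_nat[OF p1, of b]] by simp
  then obtain n where n: "p + 1 = b * n" by auto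
  have nx: "[n = x] (mod m)"
  proof -
    have "b * (n mod m) = b * (x mod m)" using p1 unfolding n cong_def by (simp only: mod_mult_mult1)
    thus ?thesis using b by (simp add: cong_def)
  qed
  have "b * (K + q + 2) < b * n" using p(3) n by linarith
  hence n_gt: "n > K + q + 2" by (simp only: mult_less_cancel1)
  have "coprime n P"
  proof (rule ccontr)
    assume "\<not> coprime n P"
    then obtain l where l: "prime l" "l dvd n" "l dvd P"
      by (rule not_coprime_prime_divisor)
    show False
    proof (cases "l dvd b")
      case True
      have "[x = 1] (mod l)" using cong_dvd_modulus_nat[OF x(1), of l] True by simp
      moreover have "[n = x] (mod l)" using cong_dvd_modulus_nat[OF nx, of l] True by (simp add: m_def)
      ultimately have "[n = 1] (mod l)" by (metis cong_trans)
      hence "l dvd 1" using l(2) cong_dvd_iff by blast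
      thus False using l by simp
    next
      case False
      have lP': "l dvd P'" unfolding P'_def using l False P by (intro dvd_prodI) (auto simp: prime_factors_dvd)
      have "[n = x] (mod l)" using cong_dvd_modulus_nat[OF nx, of l] lP' by (simp add: m_def)
      hence "[b * n = b * x] (mod l)" by (rule cong_scalar_left)
      moreover have "[b * x = 2] (mod l)" using cong_dvd_modulus_nat[OF bx lP'] .
      ultimately have "[b * n = 2] (mod l)" by (rule cong_trans)
      moreover have "l dvd b * n" using l(2) by simp
      ultimately have "l dvd 2" using cong_dvd_iff by blast
      \<comment> \<open>This is the parity obstruction: \<open>P\<close> is even and
        \<open>b\<close> odd, which the hypothesis \<open>even\<close> excludes.\<close>
      hence "l = 2" using l(1) by (simp add: primes_dvd_imp_eq)
      thus False using even l(3) False by simp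
    qed
  qed
  moreover have "\<not> prime (n - 1)"
  proof
    assume pr: "prime (n - 1)"
    have "[n = x] (mod q)" using cong_dvd_modulus_nat[OF nx, of q] by (simp add: m_def)
    moreover have "[x = 1] (mod q)" using cong_dvd_modulus_nat[OF x(1), of q] by simp
    ultimately have "[n = 1] (mod q)" by (rule cong_trans)
    hence "q dvd n - 1" using n_gt by (subst (asm) cong_altdef_nat) auto
    hence "q = n - 1" using pr q by (simp add: primes_dvd_imp_eq)
    thus False using n_gt by simp
  qed
  moreover have "prime (b * n - 1)" using p(1) n by (metis add_diff_cancel_right')
  moreover have "n \<ge> K" "n - 1 > 1" using n_gt by auto
  ultimately show ?thesis by blast
qed

theorem theorem3:
  fixes y :: "nat \<Rightarrow> real" and C :: "nat set"
  assumes "mono_on {1..} y"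
    and "\<And>n. n \<ge> 1 \<Longrightarrow> real n / 2 < y n \<and> y n < real n"
    and "C \<subseteq> {1..}"
    and "eventually_equal C (shifted_smooth_numbers y)"
  shows "\<not> (\<exists>A B. A \<subseteq> {1..} \<and> B \<subseteq> {1..} \<and> (infinite A \<or> card A \<ge> 2) \<and>
                 finite B \<and> card B \<ge> 2 \<and> C = A * B)"
proof
  assume "\<exists>A B. A \<subseteq> {1..} \<and> B \<subseteq> {1..} \<and> (infinite A \<or> card A \<ge> 2) \<and>
                 finite B \<and> card B \<ge> 2 \<and> C = A * B"
  then obtain A B where AB: "A \<subseteq> {1..}" "B \<subseteq> {1..}" "finite B" "card B \<ge> 2" "C = A * B"
    by blast
  obtain K where K: "C \<inter> {K..} = shifted_smooth_numbers y \<inter> {K..}"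
    using assms(4) unfolding eventually_equal_def by blast
  have C_iff: "n \<in> C \<longleftrightarrow> n - 1 > 1 \<and> \<not> prime (n - 1)" if "n \<ge> K" for n
  proof -
    have "n \<in> C \<longleftrightarrow> n \<in> shifted_smooth_numbers y" using K that by blast
    also have "\<dots> \<longleftrightarrow> (\<exists>k. n = k + 1 \<and> k > 1 \<and> \<not> prime k)"
      unfolding shifted_smooth_numbers_def by (simp add: smooth_numbers_iff_composite[OF assms(2)])
    also have "\<dots> \<longleftrightarrow> n - 1 > 1 \<and> \<not> prime (n - 1)"
      by (metis add_diff_cancel_right' le_add_diff_inverse2 less_imp_le less_trans zero_less_one zero_less_diff)
    finally show ?thesis .
  qed
  define P where "P = \<Prod>B"
  have P: "P > 0" unfolding P_def using AB(2) by (intro prod_pos) auto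
  \<comment> \<open>If \<open>P\<close> is even, some factor in \<open>B\<close> is even and serves
    as \<open>b\<close>. If \<open>P\<close> is odd, any element other than 1 will do, and one
    exists since \<open>B\<close> has at least two elements.\<close>
  obtain b where b: "b \<in> B" "b > 1" "even P \<Longrightarrow> even b"
  proof (cases "even P")
    case True
    then obtain b where b: "b \<in> B" "even b"
      unfolding P_def using prime_dvd_prod_iff[OF AB(3), of 2 "\<lambda>x. x"] two_is_prime_nat by auto
    have "b \<ge> 1" using b AB(2) by auto
    hence "b > 1" using b(2) by (cases "b = 1") auto
    thus ?thesis using that b by blast
  next
    case False
    have "\<not> B \<subseteq> {1}" using AB(4) card_mono[of "{1}" B] by auto
    then obtain b where "b \<in> B" "b \<noteq> 1" by auto
    moreover have "b \<ge> 1" using calculation AB(2) by auto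
    ultimately show ?thesis using that[of b] False by auto
  qed
  obtain n where n: "n \<ge> K" "coprime n P" "n - 1 > 1" "\<not> prime (n - 1)" "prime (b * n - 1)"
    using exists_prime_multiple_minus_one[OF b(2) P b(3)] by blast
  have "n \<in> A * B" using C_iff[OF n(1)] n(3,4) AB(5) by blast
  then obtain a b' where ab: "a \<in> A" "b' \<in> B" "n = a * b'" by (auto elim: set_times_elim)
  \<comment> \<open>The factor \<open>b'\<close> divides both \<open>n\<close> and \<open>P\<close>,
    so it is 1 and \<open>n = a\<close> lies in \<open>A\<close>. Hence \<open>n * b\<close> lies in
    \<open>C\<close>, although \<open>b * n - 1\<close> is prime.\<close>
  have "b' dvd P" unfolding P_def using ab(2) AB(3) by (intro dvd_prodI) auto
  hence "b' = 1" using n(2) ab(3) by (metis coprime_common_divisor_nat dvd_triv_right)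
  hence "n * b \<in> C" using ab b(1) AB(5) by (auto intro: set_times_intro)
  moreover have "K \<le> n * b" using n(1) b(2) by (metis le_trans less_imp_le mult.right_neutral mult_le_mono2)
  ultimately show False using C_iff[of "n * b"] n(5) by (simp add: mult.commute)
qed

end
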